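(* Let $p$ be a prime and let $\mathcal{F}=\{F_1,\dots,F_n\}$ with $F_i(x)=(-1)^{b_i}p^{k_i}x+d_i$, where $b_i\in\{0,1\}$, $k_i\in\mathbb{Z}$, $k_i\ge1$ and $d_i\in\mathbb{Z}_p\cap\mathbb{Q}$, and let $K$ be its $p$-adic self-similar set. Let $K'\subseteq K$ be the set of non-essential points of $K$, let $d=\dim_{H}(K)$ and let $\mu_K=H^{d}_p$ be the $d$-dimensional Hausdorff measure on $\mathbb{Q}_p$. Then (1) $0<\mu_K(K)<\infty$; (2) $\mu_K(K')=0$; (3) $\dim_H(K')<\dim_H(K)$.
   Context: $K$ is the unique non-empty compact subset of $\mathbb{Q}_p$ with $K=\bigcup_iF_i(K)$; $K\subseteq\mathbb{Z}_p$. Hausdorff measure $H^d_p$ and Hausdorff dimension are with respect to the $p$-adic metric $|x-y|_p$. For $m\ge1$ and $x\in\mathbb{Z}_p$ let $D_m(x)\in\{0,\dots,p^m-1\}$ be the integer with $x\equiv D_m(x)\pmod{p^m}$. The transducer of $\mathcal{F}$ has states $(c,\varepsilon)$ with $c\in\mathbb{Z}_p\cap\mathbb{Q}$, $\varepsilon\in\{+1,-1\}$, initial state $(0,+1)$; from $(c,\varepsilon)$ and for each $i$ there is a transition reading $i$, outputting the $k_i$ $p$-adic digits of $D_{k_i}(c+\varepsilon d_i)$ (least significant first), and going to $\big(p^{-k_i}(c+\varepsilon d_i-D_{k_i}(c+\varepsilon d_i)),\ \varepsilon(-1)^{b_i}\big)$; only states reachable from the initial state are kept (finitely many). The NDFA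 of $\mathcal{F}$ is obtained by forgetting the inputs and replacing each transition outputting $k$ digits by a path of $k$ single-digit edges through $k-1$ new intermediate states; all states are accepting; it recognizes the $p$-adic expansions of the elements of $K$. The DFA of $\mathcal{F}$ is obtained from this NDFA by the subset construction (states are sets of NDFA states reachable from $\{\text{initial}\}$; on digit $a$, a set $S$ goes to the set of NDFA states reachable from a state of $S$ by an edge labelled $a$). An essential class of a directed graph is a maximal set of states any two of which are joined by paths inside it, such that every path starting in it stays in it. A point $x\in K$ is essential if the (unique) path in the DFA labelled by the $p$-adic expansion of $x$ is eventually contained in an essential class of the DFA, and non-essential otherwise. *)

theory Defs
  imports "HOL-Analysis.Analysis" "HOL-Computational_Algebra.Fraction_Field"
    "Berlekamp_Zassenhaus.Finite_Field"
begin

section \<open>The ring of \<open>p\<close>-adic integers\<close>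

text \<open>
  The prime \<open>p\<close> is the cardinality of a type of class \<^class>\<open>prime_card\<close>. The ring
  \<open>\<int>\<^sub>p\<close> is the inverse limit of the rings \<open>\<int>/p\<^sup>m\<close>, whose elements are represented by
  the integers in \<open>{0..<p\<^sup>m}\<close>.
\<close>

abbreviation pp :: "'p::prime_card itself \<Rightarrow> int" where
  "pp _ \<equiv> int CARD('p)"

lemma pp_gt_1: "pp TYPE('p::prime_card) > 1"
  using prime_card[where 'a='p] prime_gt_1_nat by auto

lemma pp_pow_pos [simp]: "pp TYPE('p::prime_card) ^ m > 0"
  using pp_gt_1[where 'p='p] by (intro zero_less_power) linarith

typedef (overloaded) 'p padic_int =
  "{x :: nat \<Rightarrow> int. \<forall>m. x m \<in> {0..<pp TYPE('p::prime_card) ^ m}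
      \<and> x (Suc m) mod pp TYPE('p) ^ m = x m}"
  by (rule exI[of _ "\<lambda>_. 0"]) auto

setup_lifting type_definition_padic_int

lemma pp_mod_mod: "a mod pp TYPE('p::prime_card) ^ Suc m mod pp TYPE('p) ^ m = a mod pp TYPE('p) ^ m"
  by (rule mod_mod_cancel) simp

lemma pp_mod_range: "a mod pp TYPE('p::prime_card) ^ m \<in> {0..<pp TYPE('p) ^ m}"
  by (simp del: of_nat_power)

instantiation padic_int :: (prime_card) comm_ring_1
begin

lift_definition zero_padic_int :: "'a padic_int" is "\<lambda>_. 0"
  by auto

lift_definition one_padic_int :: "'a padic_int" is "\<lambda>m. 1 mod pp TYPE('a) ^ m"
  using pp_mod_mod pp_mod_range by blast

lift_definition plus_padic_int :: "'a padic_int \<Rightarrow> 'a padic_int \<Rightarrow> 'a padic_int"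
  is "\<lambda>x y m. (x m + y m) mod pp TYPE('a) ^ m"
proof (intro allI conjI, goal_cases)
  case (1 x y m)
  show ?case by (rule pp_mod_range)
next
  case (2 x y m)
  have "(x (Suc m) + y (Suc m)) mod pp TYPE('a) ^ Suc m mod pp TYPE('a) ^ m
      = (x (Suc m) mod pp TYPE('a) ^ m + y (Suc m) mod pp TYPE('a) ^ m) mod pp TYPE('a) ^ m"
    unfolding pp_mod_mod by (rule mod_add_eq[symmetric])
  then show ?case using 2 by presburger
qed

lift_definition uminus_padic_int :: "'a padic_int \<Rightarrow> 'a padic_int"
  is "\<lambda>x m. (- x m) mod pp TYPE('a) ^ m"
proof (intro allI conjI, goal_cases)
  case (1 x m)
  show ?case by (rule pp_mod_range)
next
  case (2 x m)
  have "(- x (Suc m)) mod pp TYPE('a) ^ Suc m mod pp TYPE('a) ^ m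
      = (- (x (Suc m) mod pp TYPE('a) ^ m)) mod pp TYPE('a) ^ m"
    unfolding pp_mod_mod by (rule mod_minus_eq[symmetric])
  then show ?case using 2 by presburger
qed

definition minus_padic_int :: "'a padic_int \<Rightarrow> 'a padic_int \<Rightarrow> 'a padic_int" where
  "minus_padic_int x y = x + - y"

lift_definition times_padic_int :: "'a padic_int \<Rightarrow> 'a padic_int \<Rightarrow> 'a padic_int"
  is "\<lambda>x y m. (x m * y m) mod pp TYPE('a) ^ m"
proof (intro allI conjI, goal_cases)
  case (1 x y m)
  show ?case by (rule pp_mod_range)
next
  case (2 x y m)
  have "(x (Suc m) * y (Suc m)) mod pp TYPE('a) ^ Suc m mod pp TYPE('a) ^ m
      = (x (Suc m) mod pp TYPE('a) ^ m * (y (Suc m) mod pp TYPE('a) ^ m)) mod pp TYPE('a) ^ m"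
    unfolding pp_mod_mod by (rule mod_mult_eq[symmetric])
  then show ?case using 2 by presburger
qed

instance
proof
  fix x y z :: "'a padic_int"
  show "x * y * z = x * (y * z)"
    by transfer (auto simp: mod_simps ac_simps simp del: of_nat_power)
  show "x * y = y * x"
    by transfer (auto simp: mod_simps ac_simps simp del: of_nat_power)
  show "1 * x = x"
    by transfer (auto simp: mod_simps fun_eq_iff simp del: of_nat_power)
  show "x + y + z = x + (y + z)"
    by transfer (auto simp: mod_simps ac_simps simp del: of_nat_power)
  show "x + y = y + x"
    by transfer (auto simp: mod_simps ac_simps simp del: of_nat_power)
  show "0 + x = x"
    by transfer (auto simp: mod_simps fun_eq_iff simp del: of_nat_power)
  show "- x + x = 0"
    by transfer (auto simp: mod_simps fun_eq_iff simp del: of_nat_power)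
  show "x - y = x + - y"
    by (simp add: minus_padic_int_def)
  show "(x + y) * z = x * z + y * z"
    by transfer (auto simp: mod_simps algebra_simps simp del: of_nat_power)
  show "(0 :: 'a padic_int) \<noteq> 1"
  proof (transfer, rule notI)
    assume "(\<lambda>_. 0) = (\<lambda>m. 1 mod pp TYPE('a) ^ m)"
    from fun_cong[OF this, of 1] show False using pp_gt_1[where 'p='a] by simp
  qed
qed

end

lemma Rep_padic_int_range: "Rep_padic_int (x :: 'p::prime_card padic_int) m \<in> {0..<pp TYPE('p) ^ m}"
  and Rep_padic_int_Suc: "Rep_padic_int x (Suc m) mod pp TYPE('p) ^ m = Rep_padic_int x m"
  using Rep_padic_int[of x] by blast+

lemma Rep_padic_int_mod:
  "m \<le> n \<Longrightarrow> Rep_padic_int (x :: 'p::prime_card padic_int) n mod pp TYPE('p) ^ m = Rep_padic_int x m"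
proof (induction n rule: dec_induct)
  case base
  then show ?case using Rep_padic_int_range[of x m] by (simp del: of_nat_power)
next
  case (step n)
  have "pp TYPE('p) ^ m dvd pp TYPE('p) ^ n" using step by (simp add: le_imp_power_dvd del: of_nat_power)
  then have "Rep_padic_int x (Suc n) mod pp TYPE('p) ^ m
      = Rep_padic_int x (Suc n) mod pp TYPE('p) ^ n mod pp TYPE('p) ^ m"
    by (rule mod_mod_cancel[symmetric])
  then show ?case using step Rep_padic_int_Suc[of x n] by presburger
qed

lemma Rep_padic_int_of_nat:
  "Rep_padic_int (of_nat n :: 'p::prime_card padic_int) m = int n mod pp TYPE('p) ^ m"
proof (induction n)
  case 0
  then show ?case by (simp add: zero_padic_int.rep_eq)
next
  case (Suc n)
  then show ?case
    by (simp add: plus_padic_int.rep_eq one_padic_int.rep_eq mod_simps del: of_nat_power)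
qed

lift_definition padic_int_val :: "'p::prime_card padic_int \<Rightarrow> nat" is
  "\<lambda>x. LEAST m. x (Suc m) \<noteq> 0" .

text \<open>On nonzero elements, \<^const>\<open>padic_int_val\<close> is the exponent of the largest power of
  \<open>p\<close> dividing the argument.\<close>

lemma padic_int_val_iff:
  fixes x :: "'p::prime_card padic_int"
  assumes "x \<noteq> 0"
  shows "Rep_padic_int x m = 0 \<longleftrightarrow> m \<le> padic_int_val x"
proof -
  from assms obtain m0 where m0: "Rep_padic_int x m0 \<noteq> 0"
    by (metis Rep_padic_int_inject ext zero_padic_int.rep_eq)
  have zero: "Rep_padic_int x 0 = 0"
    using Rep_padic_int_range[of x 0] by simp
  with m0 obtain m1 where "Rep_padic_int x (Suc m1) \<noteq> 0" by (cases m0) auto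
  then have nz: "Rep_padic_int x (Suc (padic_int_val x)) \<noteq> 0"
    unfolding padic_int_val.rep_eq by (rule LeastI)
  show ?thesis
  proof
    assume "Rep_padic_int x m = 0"
    then show "m \<le> padic_int_val x"
      using nz Rep_padic_int_mod[of "Suc (padic_int_val x)" m x] by (metis mod_0 not_less_eq_eq)
  next
    assume le: "m \<le> padic_int_val x"
    show "Rep_padic_int x m = 0"
    proof (cases m)
      case 0
      then show ?thesis using zero by simp
    next
      case (Suc k)
      then have "k < padic_int_val x" using le by simp
      then show ?thesis unfolding padic_int_val.rep_eq Suc using not_less_Least by blast
    qed
  qed
qed

lemma padic_int_val_dvd:
  fixes x :: "'p::prime_card padic_int"
  assumes "x \<noteq> 0" "k \<le> M" 
  shows "pp TYPE('p) ^ k dvd Rep_padic_int x M \<longleftrightarrow> k \<le> padic_int_val x"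
  using padic_int_val_iff[OF assms(1), of k] Rep_padic_int_mod[OF assms(2), of x]
  by (metis mod_eq_0_iff_dvd)

lemma padic_int_val_eqI:
  fixes x :: "'p::prime_card padic_int"
  assumes "Rep_padic_int x k = 0" "Rep_padic_int x (Suc k) \<noteq> 0"
  shows "x \<noteq> 0" "padic_int_val x = k"
proof -
  show "x \<noteq> 0" using assms(2) by (auto simp: zero_padic_int.rep_eq)
  from padic_int_val_iff[OF this] assms show "padic_int_val x = k"
    by (metis le_antisym not_less_eq_eq)
qed

lemma padic_int_mult_aux:
  fixes x y :: "'p::prime_card padic_int"
  assumes "x \<noteq> 0" "y \<noteq> 0"
  shows "x * y \<noteq> 0 \<and> padic_int_val (x * y) = padic_int_val x + padic_int_val y"
proof -
  define v w where "v = padic_int_val x" and "w = padic_int_val y"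
  let ?p = "pp TYPE('p)"
  let ?M = "Suc (v + w)"
  have pr: "prime ?p" using prime_card_int .
  have p0: "?p ^ k \<noteq> 0" for k using pp_pow_pos[where 'p='p, of k] by linarith
  obtain a where a: "Rep_padic_int x ?M = ?p ^ v * a"
    using padic_int_val_dvd[OF assms(1), of v ?M] v_def by (auto simp del: of_nat_power)
  obtain b where b: "Rep_padic_int y ?M = ?p ^ w * b"
    using padic_int_val_dvd[OF assms(2), of w ?M] w_def by (auto simp del: of_nat_power)
  have na: "\<not> ?p dvd a"
  proof
    assume "?p dvd a"
    then have "?p ^ Suc v dvd Rep_padic_int x ?M"
      unfolding a power_Suc2 by (rule mult_dvd_mono[OF dvd_refl])
    then show False using padic_int_val_dvd[OF assms(1), of "Suc v" ?M] v_def by simp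
  qed
  have nb: "\<not> ?p dvd b"
  proof
    assume "?p dvd b"
    then have "?p ^ Suc w dvd Rep_padic_int y ?M"
      unfolding b power_Suc2 by (rule mult_dvd_mono[OF dvd_refl])
    then show False using padic_int_val_dvd[OF assms(2), of "Suc w" ?M] w_def by simp
  qed
  have nab: "\<not> ?p dvd a * b" using na nb pr by (simp add: prime_dvd_mult_iff)
  have prod: "Rep_padic_int x ?M * Rep_padic_int y ?M = ?p ^ (v + w) * (a * b)"
    unfolding a b power_add by (simp only: ac_simps)
  have ne: "Rep_padic_int (x * y) ?M \<noteq> 0"
  proof
    assume "Rep_padic_int (x * y) ?M = 0"
    then have "?p ^ ?M dvd ?p ^ (v + w) * (a * b)"
      unfolding times_padic_int.rep_eq prod by (simp only: mod_eq_0_iff_dvd)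
    then have "?p dvd a * b"
      unfolding power_Suc2 using p0 by (metis dvd_mult_cancel_left)
    with nab show False by simp
  qed
  have "Rep_padic_int (x * y) (v + w) = Rep_padic_int (x * y) ?M mod ?p ^ (v + w)"
    by (rule Rep_padic_int_Suc[symmetric])
  also have "\<dots> = (?p ^ (v + w) * (a * b)) mod ?p ^ (v + w)"
    unfolding times_padic_int.rep_eq prod by (rule pp_mod_mod)
  finally have "Rep_padic_int (x * y) (v + w) = 0" by simp
  from padic_int_val_eqI[OF this ne] show ?thesis unfolding v_def w_def by simp
qed

instance padic_int :: (prime_card) idom
  by standard (use padic_int_mult_aux in blast)

definition padic_int_abs :: "'p::prime_card padic_int \<Rightarrow> real" where
  "padic_int_abs x = (if x = 0 then 0 else (1 / real CARD('p)) ^ padic_int_val x)"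

lemma padic_int_abs_eq_0 [simp]: "padic_int_abs x = 0 \<longleftrightarrow> x = 0"
  by (simp add: padic_int_abs_def)

lemma padic_int_abs_1 [simp]: "padic_int_abs (1 :: 'p::prime_card padic_int) = 1"
proof -
  have "padic_int_val (1 :: 'p padic_int) = 0"
    using padic_int_mult_aux[of "1 :: 'p padic_int" 1] by simp
  then show ?thesis by (simp add: padic_int_abs_def)
qed

lemma padic_int_abs_mult: "padic_int_abs (x * y) = padic_int_abs x * padic_int_abs y"
  by (simp add: padic_int_abs_def padic_int_mult_aux power_add del: mult_eq_0_iff)

lemma padic_int_abs_nonneg [simp]: "0 \<le> padic_int_abs x"
  by (simp add: padic_int_abs_def)

lemma padic_int_abs_add: "padic_int_abs (x + y) \<le> max (padic_int_abs x) (padic_int_abs y)"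
proof (cases "x = 0 \<or> y = 0 \<or> x + y = 0")
  case True
  then show ?thesis by (auto simp: padic_int_abs_def le_max_iff_disj)
next
  case False
  let ?m = "min (padic_int_val x) (padic_int_val y)"
  have "Rep_padic_int x ?m = 0" "Rep_padic_int y ?m = 0"
    using False padic_int_val_iff[of x ?m] padic_int_val_iff[of y ?m] by auto
  then have "Rep_padic_int (x + y) ?m = 0" by (simp add: plus_padic_int.rep_eq)
  then have "?m \<le> padic_int_val (x + y)" using False padic_int_val_iff by blast
  then have "(1 / real CARD('a)) ^ padic_int_val (x + y) \<le> (1 / real CARD('a)) ^ ?m"
    by (intro power_decreasing) auto
  then show ?thesis using False by (auto simp: padic_int_abs_def min_def split: if_splits)
qed


section \<open>The field of \<open>p\<close>-adic numbers\<close>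

typedef (overloaded) 'p padic = "UNIV :: 'p::prime_card padic_int fract set" ..

setup_lifting type_definition_padic

instantiation padic :: (prime_card) field
begin

lift_definition zero_padic :: "'a padic" is 0 .
lift_definition one_padic :: "'a padic" is 1 .
lift_definition plus_padic :: "'a padic \<Rightarrow> 'a padic \<Rightarrow> 'a padic" is "(+)" .
lift_definition minus_padic :: "'a padic \<Rightarrow> 'a padic \<Rightarrow> 'a padic" is "(-)" .
lift_definition uminus_padic :: "'a padic \<Rightarrow> 'a padic" is uminus .
lift_definition times_padic :: "'a padic \<Rightarrow> 'a padic \<Rightarrow> 'a padic" is "(*)" .
lift_definition inverse_padic :: "'a padic \<Rightarrow> 'a padic" is inverse .
lift_definition divide_padic :: "'a padic \<Rightarrow> 'a padic \<Rightarrow> 'a padic" is "(div)" .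

instance
  by (standard; transfer) (auto simp: algebra_simps divide_fract_def)

end

definition padic_of_int :: "'p::prime_card padic_int \<Rightarrow> 'p padic" where
  "padic_of_int x = Abs_padic (Fract x 1)"

lemma Rep_padic_of_int: "Rep_padic (padic_of_int x) = Fract x 1"
  by (simp add: padic_of_int_def Abs_padic_inverse)

lemma padic_of_nat: "of_nat n = padic_of_int (of_nat n)"
proof -
  have "Rep_padic (of_nat n :: 'a padic) = of_nat n"
    by (induction n) (simp_all add: zero_padic.rep_eq one_padic.rep_eq plus_padic.rep_eq)
  then show ?thesis
    by (simp add: Rep_padic_inject[symmetric] Rep_padic_of_int of_nat_fract)
qed

lemma padic_of_int_inject [simp]: "padic_of_int x = padic_of_int y \<longleftrightarrow> x = y"
  by (simp add: Rep_padic_inject[symmetric] Rep_padic_of_int eq_fract)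

lemma padic_of_int_0 [simp]: "padic_of_int 0 = 0"
  and padic_of_int_1 [simp]: "padic_of_int 1 = 1"
  by (simp_all add: Rep_padic_inject[symmetric] Rep_padic_of_int zero_padic.rep_eq one_padic.rep_eq fract_collapse)

lemma padic_of_int_add: "padic_of_int (x + y) = padic_of_int x + padic_of_int y"
  and padic_of_int_mult: "padic_of_int (x * y) = padic_of_int x * padic_of_int y"
  and padic_of_int_diff: "padic_of_int (x - y) = padic_of_int x - padic_of_int y"
  by (simp_all add: Rep_padic_inject[symmetric] Rep_padic_of_int plus_padic.rep_eq
      times_padic.rep_eq minus_padic.rep_eq)

instance padic :: (prime_card) field_char_0
proof
  show "inj (of_nat :: nat \<Rightarrow> 'a padic)"
  proof (rule injI)
    fix n k :: nat
    assume "of_nat n = (of_nat k :: 'a padic)"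
    then have eq: "(of_nat n :: 'a padic_int) = of_nat k" by (simp add: padic_of_nat)
    obtain m where "int n + int k < pp TYPE('a) ^ m"
    proof -
      have "n + k < 2 ^ (n + k)" by (rule less_exp)
      also have "\<dots> \<le> CARD('a) ^ (n + k)"
        using pp_gt_1[where 'p='a] by (intro power_mono) auto
      finally show ?thesis using that[of "n + k"]
        by (metis of_nat_add of_nat_less_iff of_nat_power)
    qed
    then have "int n < pp TYPE('a) ^ m" "int k < pp TYPE('a) ^ m" by linarith+
    moreover have "int n mod pp TYPE('a) ^ m = int k mod pp TYPE('a) ^ m"
      using eq Rep_padic_int_of_nat by metis
    ultimately show "n = k" by (simp del: of_nat_power)
  qed
qed

definition fract_abs :: "'p::prime_card padic_int fract \<Rightarrow> real" where
  "fract_abs q = (THE r. \<exists>a b. b \<noteq> 0 \<and> q = Fract a b \<and> r = padic_int_abs a / padic_int_abs b)"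

lemma fract_abs_Fract:
  assumes "b \<noteq> 0"
  shows "fract_abs (Fract a b) = padic_int_abs a / padic_int_abs b"
  unfolding fract_abs_def
proof (rule the_equality)
  show "\<exists>c d. d \<noteq> 0 \<and> Fract a b = Fract c d \<and>
      padic_int_abs a / padic_int_abs b = padic_int_abs c / padic_int_abs d"
    using assms by blast
next
  fix r
  assume "\<exists>c d. d \<noteq> 0 \<and> Fract a b = Fract c d \<and> r = padic_int_abs c / padic_int_abs d"
  then obtain c d where *: "d \<noteq> 0" "a * d = c * b" "r = padic_int_abs c / padic_int_abs d"
    using assms by (auto simp: eq_fract)
  have "padic_int_abs a * padic_int_abs d = padic_int_abs c * padic_int_abs b"
    using *(2) by (simp flip: padic_int_abs_mult)
  then show "r = padic_int_abs a / padic_int_abs b"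
    using *(1,3) assms by (simp add: frac_eq_eq)
qed

lemma fract_abs_add: "fract_abs (x + y) \<le> max (fract_abs x) (fract_abs y)"
proof (cases x, cases y)
  fix a b c d :: "'a padic_int"
  assume *: "x = Fract a b" "b \<noteq> 0" "y = Fract c d" "d \<noteq> 0"
  have "padic_int_abs (a * d + c * b) \<le> max (padic_int_abs (a * d)) (padic_int_abs (c * b))"
    by (rule padic_int_abs_add)
  then have "padic_int_abs (a * d + c * b) / padic_int_abs (b * d)
      \<le> max (padic_int_abs (a * d)) (padic_int_abs (c * b)) / padic_int_abs (b * d)"
    by (intro divide_right_mono) simp_all
  also have "\<dots> = max (padic_int_abs (a * d) / padic_int_abs (b * d)) (padic_int_abs (c * b) / padic_int_abs (b * d))"
    by (simp add: max_divide_distrib_right)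
  also have "\<dots> = max (fract_abs x) (fract_abs y)"
    using * by (simp add: fract_abs_Fract padic_int_abs_mult)
  also have "padic_int_abs (a * d + c * b) / padic_int_abs (b * d) = fract_abs (x + y)"
    using * by (simp add: fract_abs_Fract)
  finally show ?thesis .
qed

lift_definition padic_abs :: "'p::prime_card padic \<Rightarrow> real" is fract_abs .

lemma padic_abs_nonneg [simp]: "0 \<le> padic_abs x"
proof transfer
  show "0 \<le> fract_abs x" for x :: "'a padic_int fract"
    by (cases x) (simp add: fract_abs_Fract)
qed

lemma padic_abs_eq_0 [simp]: "padic_abs x = 0 \<longleftrightarrow> x = 0"
proof transfer
  show "fract_abs x = 0 \<longleftrightarrow> x = 0" for x :: "'a padic_int fract"
    by (cases x) (simp add: fract_abs_Fract Zero_fract_def eq_fract)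
qed

lemma padic_abs_add: "padic_abs (x + y) \<le> max (padic_abs x) (padic_abs y)"
  by transfer (rule fract_abs_add)

lemma padic_abs_mult: "padic_abs (x * y) = padic_abs x * padic_abs y"
proof transfer
  show "fract_abs (x * y) = fract_abs x * fract_abs y" for x y :: "'a padic_int fract"
    by (cases x; cases y) (simp add: fract_abs_Fract padic_int_abs_mult)
qed

lemma padic_abs_of_int: "padic_abs (padic_of_int x) = padic_int_abs x"
  by (simp add: padic_abs.rep_eq Rep_padic_of_int fract_abs_Fract)

lemma padic_abs_minus [simp]: "padic_abs (- x) = padic_abs x"
proof -
  have "padic_abs (- 1 :: 'a padic) * padic_abs (- 1 :: 'a padic) = padic_abs (padic_of_int 1 :: 'a padic)"
    by (simp flip: padic_abs_mult)
  also have "\<dots> = 1" unfolding padic_abs_of_int by simp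
  finally have "padic_abs (- 1 :: 'a padic) = 1"
    using padic_abs_nonneg[of "- 1 :: 'a padic"] by (auto simp: square_eq_1_iff simp del: padic_abs_nonneg)
  then show ?thesis using padic_abs_mult[of "-1" x] by simp
qed

lemma padic_abs_p: "padic_abs (of_nat CARD('p) :: 'p::prime_card padic) = 1 / real CARD('p)"
proof -
  let ?x = "of_nat CARD('p) :: 'p padic_int"
  have "Rep_padic_int ?x 1 = 0" "Rep_padic_int ?x (Suc 1) \<noteq> 0"
    using pp_gt_1[where 'p='p] by (simp_all add: Rep_padic_int_of_nat power2_eq_square)
  from padic_int_val_eqI[OF this] show ?thesis
    by (simp add: padic_of_nat padic_abs_of_int padic_int_abs_def)
qed

instantiation padic :: (prime_card) metric_space
begin

definition dist_padic :: "'a padic \<Rightarrow> 'a padic \<Rightarrow> real" where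
  "dist_padic x y = padic_abs (x - y)"

definition uniformity_padic :: "('a padic \<times> 'a padic) filter" where
  "uniformity_padic = (INF e\<in>{0 <..}. principal {(x, y). dist x y < e})"

definition open_padic :: "'a padic set \<Rightarrow> bool" where
  "open_padic U \<longleftrightarrow> (\<forall>x\<in>U. eventually (\<lambda>(x', y). x' = x \<longrightarrow> y \<in> U) uniformity)"

instance
proof
  show "uniformity = (INF e\<in>{0 <..}. principal {(x :: 'a padic, y). dist x y < e})"
    by (rule uniformity_padic_def)
  show "open U \<longleftrightarrow> (\<forall>x\<in>U. eventually (\<lambda>(x', y). x' = x \<longrightarrow> y \<in> U) uniformity)"
    for U :: "'a padic set"
    by (rule open_padic_def)
  show "dist x y = 0 \<longleftrightarrow> x = y" for x y :: "'a padic"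
    by (simp add: dist_padic_def)
  show "dist x y \<le> dist x z + dist y z" for x y z :: "'a padic"
  proof -
    have "padic_abs (x - y) \<le> max (padic_abs (x - z)) (padic_abs (- (y - z)))"
      using padic_abs_add[of "x - z" "- (y - z)"] by simp
    then show ?thesis
      using padic_abs_nonneg[of "x - z"] padic_abs_nonneg[of "y - z"]
      unfolding dist_padic_def padic_abs_minus by linarith
  qed
qed

end

definition padic_ints :: "'p::prime_card padic set" where
  "padic_ints = range padic_of_int"

text \<open>\<open>padic_residue m x\<close> is \<open>D\<^sub>m(x)\<close>, for \<open>x \<in> \<int>\<^sub>p\<close>.\<close>

definition padic_residue :: "nat \<Rightarrow> 'p::prime_card padic \<Rightarrow> nat" where
  "padic_residue m x = (THE r. r < CARD('p) ^ m \<and>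
     (\<exists>z\<in>padic_ints. x - of_nat r = of_nat CARD('p) ^ m * z))"

lemma padic_int_dvd_power:
  fixes x :: "'p::prime_card padic_int"
  assumes "Rep_padic_int x m = 0"
  shows "\<exists>z. x = of_nat CARD('p) ^ m * z"
proof -
  let ?p = "pp TYPE('p)"
  have pne: "?p ^ k \<noteq> 0" for k using pp_pow_pos[where 'p='p, of k] by linarith
  define f where "f j = Rep_padic_int x (j + m) div ?p ^ m" for j
  have dv: "Rep_padic_int x (j + m) = ?p ^ m * f j" for j
    using Rep_padic_int_mod[of m "j + m" x] assms unfolding f_def by auto
  have "f j \<in> {0..<?p ^ j} \<and> f (Suc j) mod ?p ^ j = f j" for j
  proof
    have "0 \<le> ?p ^ m * f j" "?p ^ m * f j < ?p ^ m * ?p ^ j"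
      using Rep_padic_int_range[of x "j + m"] dv[of j]
      by (simp_all add: power_add mult.commute del: of_nat_power)
    then show "f j \<in> {0..<?p ^ j}"
      using pp_pow_pos[where 'p='p, of m]
      by (auto simp: zero_le_mult_iff simp del: of_nat_power pp_pow_pos)
    have "?p ^ m * (f (Suc j) mod ?p ^ j) = (?p ^ m * f (Suc j)) mod (?p ^ m * ?p ^ j)"
      by (rule mult_mod_right)
    also have "\<dots> = ?p ^ m * f j"
      using Rep_padic_int_Suc[of x "j + m"] dv[of j] dv[of "Suc j"]
      by (simp add: power_add mult.commute del: of_nat_power)
    finally show "f (Suc j) mod ?p ^ j = f j" using pne by simp
  qed
  then have R: "Rep_padic_int (Abs_padic_int f :: 'p padic_int) = f"
    by (intro Abs_padic_int_inverse) auto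
  define z where "z = (Abs_padic_int f :: 'p padic_int)"
  have "Rep_padic_int (of_nat (CARD('p) ^ m) * z) j = Rep_padic_int x j" for j
  proof -
    have "Rep_padic_int (of_nat (CARD('p) ^ m) * z) j = (?p ^ m * f j) mod ?p ^ j"
      unfolding times_padic_int.rep_eq z_def R Rep_padic_int_of_nat by (simp add: mod_simps)
    also have "\<dots> = Rep_padic_int x j"
      using Rep_padic_int_mod[of j "j + m" x] dv[of j] by simp
    finally show ?thesis .
  qed
  then have "of_nat (CARD('p) ^ m) * z = x"
    by (simp only: Rep_padic_int_inject[symmetric] fun_eq_iff simp_thms)
  then show ?thesis by (metis of_nat_power)
qed

lemma padic_p_power:
  "(of_nat CARD('p) :: 'p::prime_card padic) ^ m = padic_of_int (of_nat CARD('p) ^ m)"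
  by (metis of_nat_power padic_of_nat)

lemma padic_residue_padic_of_int:
  fixes x :: "'p::prime_card padic_int"
  shows "padic_residue m (padic_of_int x) = nat (Rep_padic_int x m)"
  unfolding padic_residue_def
proof (rule the_equality)
  let ?p = "pp TYPE('p)" and ?r = "nat (Rep_padic_int x m)"
  have r: "int ?r = Rep_padic_int x m" "Rep_padic_int x m < ?p ^ m"
    using Rep_padic_int_range[of x m] by (simp_all del: of_nat_power)
  have "Rep_padic_int (x - of_nat ?r) m = 0"
    unfolding minus_padic_int_def plus_padic_int.rep_eq uminus_padic_int.rep_eq
      Rep_padic_int_of_nat r by (simp add: mod_simps del: of_nat_power)
  then obtain z where "x - of_nat ?r = of_nat CARD('p) ^ m * z"
    using padic_int_dvd_power by blast
  then have "padic_of_int (x - of_nat ?r) = padic_of_int (of_nat CARD('p) ^ m * z)"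
    by simp
  then have "padic_of_int x - of_nat ?r = (of_nat CARD('p) :: 'p padic) ^ m * padic_of_int z"
    by (simp only: padic_of_int_diff padic_of_int_mult padic_p_power[symmetric] padic_of_nat[symmetric])
  moreover have "?r < CARD('p) ^ m"
    using r by (metis of_nat_less_iff of_nat_power)
  ultimately show "?r < CARD('p) ^ m \<and>
      (\<exists>z\<in>padic_ints. padic_of_int x - of_nat ?r = (of_nat CARD('p) :: 'p padic) ^ m * z)"
    unfolding padic_ints_def by blast
next
  let ?p = "pp TYPE('p)"
  fix r
  assume *: "r < CARD('p) ^ m \<and>
      (\<exists>z\<in>padic_ints. padic_of_int x - of_nat r = (of_nat CARD('p) :: 'p padic) ^ m * z)"
  then obtain z where "padic_of_int x - of_nat r = (of_nat CARD('p) :: 'p padic) ^ m * padic_of_int z"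
    unfolding padic_ints_def by blast
  then have "x = of_nat r + of_nat (CARD('p) ^ m) * z"
    unfolding padic_p_power padic_of_nat[of r] padic_of_int_diff[symmetric]
      padic_of_int_mult[symmetric] padic_of_int_inject by (simp add: algebra_simps)
  moreover have "Rep_padic_int (of_nat CARD('p) ^ m :: 'p padic_int) m = 0"
    using Rep_padic_int_of_nat[where 'p='p, of "CARD('p) ^ m" m] by simp
  ultimately have "Rep_padic_int x m = int r mod ?p ^ m"
    by (simp add: plus_padic_int.rep_eq times_padic_int.rep_eq Rep_padic_int_of_nat mod_simps)
  moreover have "int r < ?p ^ m" using * by (metis of_nat_less_iff of_nat_power)
  ultimately show "r = nat (Rep_padic_int x m)" by (simp del: of_nat_power)
qed

definition padic_digit :: "'p::prime_card padic \<Rightarrow> nat \<Rightarrow> nat" where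
  "padic_digit x j = padic_residue (Suc j) x div CARD('p) ^ j"


section \<open>Hausdorff measure and dimension\<close>

text \<open>
  The summand of a cover is \<open>(diam U)\<^sup>s\<close> with the conventions \<open>0\<^sup>0 = 1\<close> for nonempty \<open>U\<close>
  (whereas \<open>0 powr 0 = 0\<close>), and \<open>0\<close> for \<open>U = {}\<close>. Boundedness is required because
  \<^const>\<open>diameter\<close> is unspecified on unbounded sets. Only \<open>s \<ge> 0\<close> is relevant.
\<close>

definition diam_power :: "real \<Rightarrow> 'a::metric_space set \<Rightarrow> ennreal" where
  "diam_power s U =
     (if U = {} then 0 else if s = 0 then 1 else ennreal (diameter U powr s))"

definition hausdorff_premeasure :: "real \<Rightarrow> real \<Rightarrow> 'a::metric_space set \<Rightarrow> ennreal" where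
  "hausdorff_premeasure s \<delta> A =
     (INF U\<in>{U :: nat \<Rightarrow> 'a set. A \<subseteq> (\<Union>i. U i) \<and> (\<forall>i. bounded (U i) \<and> diameter (U i) \<le> \<delta>)}.
        \<Sum>i. diam_power s (U i))"

definition hausdorff_measure :: "real \<Rightarrow> 'a::metric_space set \<Rightarrow> ennreal" where
  "hausdorff_measure s A = (SUP \<delta>\<in>{0<..}. hausdorff_premeasure s \<delta> A)"

text \<open>
  The empty set has dimension \<open>-\<infinity>\<close>. This matters: if \<open>K\<close> is a single point, then it has
  dimension \<open>0\<close> and no non-essential points.
\<close>

definition hausdorff_dim :: "'a::metric_space set \<Rightarrow> ereal" where
  "hausdorff_dim A =
     (if A = {} then -\<infinity> else INF s\<in>{s. 0 \<le> s \<and> hausdorff_measure s A = 0}. ereal s)"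


section \<open>Self-similar sets in \<open>\<rat>\<^sub>p\<close>\<close>

text \<open>
  An iterated function system is given by \<open>n\<close> and families \<open>b\<close>, \<open>k\<close>, \<open>d\<close> indexed by \<open>{1..n}\<close>.
\<close>

definition padic_similarity :: "nat \<Rightarrow> nat \<Rightarrow> 'p::prime_card padic \<Rightarrow> 'p padic \<Rightarrow> 'p padic" where
  "padic_similarity b k d x = (-1) ^ b * of_nat CARD('p) ^ k * x + d"

definition is_self_similar_set ::
  "nat \<Rightarrow> (nat \<Rightarrow> nat) \<Rightarrow> (nat \<Rightarrow> nat) \<Rightarrow> (nat \<Rightarrow> 'p::prime_card padic) \<Rightarrow> 'p padic set \<Rightarrow> bool" where
  "is_self_similar_set n b k d K \<longleftrightarrow>
     K \<noteq> {} \<and> compact K \<and> K = (\<Union>i\<in>{1..n}. padic_similarity (b i) (k i) (d i) ` K)"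


section \<open>The transducer and the automata\<close>

type_synonym 'p tstate = "'p padic \<times> int"

definition transducer_value ::
  "(nat \<Rightarrow> 'p::prime_card padic) \<Rightarrow> 'p tstate \<Rightarrow> nat \<Rightarrow> 'p padic" where
  "transducer_value d s i = fst s + of_int (snd s) * d i"

definition transducer_output ::
  "(nat \<Rightarrow> nat) \<Rightarrow> (nat \<Rightarrow> 'p::prime_card padic) \<Rightarrow> 'p tstate \<Rightarrow> nat \<Rightarrow> nat list" where
  "transducer_output k d s i =
     map (\<lambda>j. padic_residue (k i) (transducer_value d s i) div CARD('p) ^ j mod CARD('p)) [0..<k i]"

definition transducer_next ::
  "(nat \<Rightarrow> nat) \<Rightarrow> (nat \<Rightarrow> nat) \<Rightarrow> (nat \<Rightarrow> 'p::prime_card padic) \<Rightarrow> 'p tstate \<Rightarrow> nat \<Rightarrow> 'p tstate" where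
  "transducer_next b k d s i =
     ((transducer_value d s i - of_nat (padic_residue (k i) (transducer_value d s i)))
        / of_nat CARD('p) ^ k i,
      snd s * (-1) ^ b i)"

inductive_set transducer_states ::
  "nat \<Rightarrow> (nat \<Rightarrow> nat) \<Rightarrow> (nat \<Rightarrow> nat) \<Rightarrow> (nat \<Rightarrow> 'p::prime_card padic) \<Rightarrow> 'p tstate set"
  for n b k d where
  initial: "(0, 1) \<in> transducer_states n b k d"
| step: "\<lbrakk>s \<in> transducer_states n b k d; i \<in> {1..n}\<rbrakk>
    \<Longrightarrow> transducer_next b k d s i \<in> transducer_states n b k d"

text \<open>\<open>Mid s i j\<close> with \<open>0 < j < k\<^sub>i\<close> is the \<open>j\<close>-th intermediate state on the path replacing the
  transition that reads \<open>i\<close> in state \<open>s\<close>.\<close>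

datatype 'p nstate = State "'p tstate" | Mid "'p tstate" nat nat

definition path_state ::
  "(nat \<Rightarrow> nat) \<Rightarrow> (nat \<Rightarrow> nat) \<Rightarrow> (nat \<Rightarrow> 'p::prime_card padic) \<Rightarrow> 'p tstate \<Rightarrow> nat \<Rightarrow> nat \<Rightarrow> 'p nstate" where
  "path_state b k d s i j =
     (if j = 0 then State s else if j = k i then State (transducer_next b k d s i) else Mid s i j)"

inductive ndfa_edge ::
  "nat \<Rightarrow> (nat \<Rightarrow> nat) \<Rightarrow> (nat \<Rightarrow> nat) \<Rightarrow> (nat \<Rightarrow> 'p::prime_card padic) \<Rightarrow>
   'p nstate \<Rightarrow> nat \<Rightarrow> 'p nstate \<Rightarrow> bool"
  for n b k d where
  "\<lbrakk>s \<in> transducer_states n b k d; i \<in> {1..n}; j < k i\<rbrakk>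
    \<Longrightarrow> ndfa_edge n b k d (path_state b k d s i j) (transducer_output k d s i ! j)
          (path_state b k d s i (Suc j))"

definition dfa_step ::
  "nat \<Rightarrow> (nat \<Rightarrow> nat) \<Rightarrow> (nat \<Rightarrow> nat) \<Rightarrow> (nat \<Rightarrow> 'p::prime_card padic) \<Rightarrow>
   'p nstate set \<Rightarrow> nat \<Rightarrow> 'p nstate set" where
  "dfa_step n b k d S a = {t. \<exists>s\<in>S. ndfa_edge n b k d s a t}"

text \<open>The empty set is not a state of the DFA: if no edge labelled \<open>a\<close> leaves \<open>S\<close>, then the DFA
  has no transition from \<open>S\<close> on \<open>a\<close>. (An absorbing empty state would be the only essential
  class whenever it is reachable.)\<close>

inductive_set dfa_states ::
  "nat \<Rightarrow> (nat \<Rightarrow> nat) \<Rightarrow> (nat \<Rightarrow> nat) \<Rightarrow> (nat \<Rightarrow> 'p::prime_card padic) \<Rightarrow> 'p nstate set set"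
  for n b k d where
  initial: "{State (0, 1)} \<in> dfa_states n b k d"
| step: "\<lbrakk>S \<in> dfa_states n b k d; dfa_step n b k d S a \<noteq> {}\<rbrakk>
    \<Longrightarrow> dfa_step n b k d S a \<in> dfa_states n b k d"

definition dfa_graph ::
  "nat \<Rightarrow> (nat \<Rightarrow> nat) \<Rightarrow> (nat \<Rightarrow> nat) \<Rightarrow> (nat \<Rightarrow> 'p::prime_card padic) \<Rightarrow>
   ('p nstate set \<times> 'p nstate set) set" where
  "dfa_graph n b k d =
     {(S, T). S \<in> dfa_states n b k d \<and> T \<noteq> {} \<and> (\<exists>a. T = dfa_step n b k d S a)}"

primrec dfa_run ::
  "nat \<Rightarrow> (nat \<Rightarrow> nat) \<Rightarrow> (nat \<Rightarrow> nat) \<Rightarrow> (nat \<Rightarrow> 'p::prime_card padic) \<Rightarrow>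
   'p padic \<Rightarrow> nat \<Rightarrow> 'p nstate set" where
  "dfa_run n b k d x 0 = {State (0, 1)}"
| "dfa_run n b k d x (Suc j) = dfa_step n b k d (dfa_run n b k d x j) (padic_digit x j)"


section \<open>Essential classes and essential points\<close>

definition joined_inside :: "('v \<times> 'v) set \<Rightarrow> 'v set \<Rightarrow> bool" where
  "joined_inside E C \<longleftrightarrow> (\<forall>u\<in>C. \<forall>v\<in>C. (u, v) \<in> (E \<inter> C \<times> C)\<^sup>*)"

definition essential_class :: "'v set \<Rightarrow> ('v \<times> 'v) set \<Rightarrow> 'v set \<Rightarrow> bool" where
  "essential_class V E C \<longleftrightarrow>
     C \<noteq> {} \<and> C \<subseteq> V \<and> joined_inside E C \<and>
     (\<forall>C'. C \<subseteq> C' \<and> C' \<subseteq> V \<and> joined_inside E C' \<longrightarrow> C' = C) \<and>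
     (\<forall>u\<in>C. \<forall>v. (u, v) \<in> E\<^sup>* \<longrightarrow> v \<in> C)"

definition is_essential ::
  "nat \<Rightarrow> (nat \<Rightarrow> nat) \<Rightarrow> (nat \<Rightarrow> nat) \<Rightarrow> (nat \<Rightarrow> 'p::prime_card padic) \<Rightarrow> 'p padic \<Rightarrow> bool" where
  "is_essential n b k d x \<longleftrightarrow>
     (\<exists>C. essential_class (dfa_states n b k d) (dfa_graph n b k d) C \<and>
        (\<forall>\<^sub>F j in sequentially. dfa_run n b k d x j \<in> C))"

definition nonessential_points ::
  "nat \<Rightarrow> (nat \<Rightarrow> nat) \<Rightarrow> (nat \<Rightarrow> nat) \<Rightarrow> (nat \<Rightarrow> 'p::prime_card padic) \<Rightarrow>
   'p padic set \<Rightarrow> 'p padic set" where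
  "nonessential_points n b k d K = {x \<in> K. \<not> is_essential n b k d x}"

end

theory Submission
  imports Defs
begin

text \<open>
  The points that can be read from any state of the NDFA form an affine copy of \<open>\<plusminus>K\<close>, scaled by a
  bounded power of \<open>p\<close>, so the number of readable words of length \<open>m\<close> is the same for all states of
  the DFA, up to constants. Hence the number \<open>N m\<close> of residues of \<open>K\<close> modulo \<open>p\<^sup>m\<close> is multiplicative
  up to constants and lies between multiples of \<open>exp (h m)\<close>, which gives dimension \<open>h / ln p\<close> with
  positive finite measure. From every state of the DFA an essential class can be entered within a
  bounded number of steps; by the same comparability a fixed proportion of the words
  does so, and the words that avoid all essential classes are exponentially rarer than \<open>N m\<close>.
\<close>


section \<open>Essential classes of finite graphs\<close>

text \<open>The DFA need not be strongly connected and may have several essential classes, so growth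
  rates of components are not compared. Homogeneity replaces that comparison: every NDFA state reads
  a scaled copy of the same set, so a transient state has as many continuations as an essential one,
  up to constants. Two points shape the estimates. A limit of \<open>ln (N m) / m\<close> would give
  only the dimension; a positive finite measure needs \<open>N m\<close> within constant factors of
  \<open>exp (h * m)\<close>. And the comparability constants must not be paid once per round, since
  their powers could swamp the loss; hence the decay is measured among all words of one fixed total
  length, and the constants affect only the size of the proportion lost.\<close>

lemma rtrancl_inside_closed:
  assumes "\<And>u v. u \<in> C \<Longrightarrow> (u, v) \<in> E\<^sup>* \<Longrightarrow> v \<in> C" "u \<in> C" "(u, v) \<in> E\<^sup>*"
  shows "(u, v) \<in> (E \<inter> C \<times> C)\<^sup>*"
  using assms(3)
proof induction
  case (step y z)
  then have "y \<in> C" "z \<in> C"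
    using assms(1)[OF assms(2)] by (meson rtrancl.rtrancl_into_rtrancl)+
  with step show ?case
    by (meson IntI SigmaI rtrancl.rtrancl_into_rtrancl)
qed simp

text \<open>Among the vertices reachable from \<open>v\<close> choose \<open>u\<close> whose own
  reachable set \<open>R u\<close> is smallest. Every \<open>w\<close> in \<open>R u\<close> then
  has \<open>R w = R u\<close>, so \<open>w\<close> leads back to \<open>u\<close>, and
  \<open>R u\<close> is strongly connected and closed.\<close>

lemma exists_reachable_essential_class:
  assumes "finite V" "E \<subseteq> V \<times> V" "v \<in> V"
  shows "\<exists>C u. essential_class V E C \<and> u \<in> C \<and> (v, u) \<in> E\<^sup>*"
proof -
  define R where "R u = {w. (u, w) \<in> E\<^sup>*}" for u
  have "w \<in> V" if "(u, w) \<in> E\<^sup>*" "u \<in> V" for u w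
    using that(1) by (cases rule: rtranclE) (use that assms(2) in auto)
  then have RV: "R u \<subseteq> V" if "u \<in> V" for u
    using that by (auto simp: R_def)
  then have fin: "finite (R u)" if "u \<in> V" for u
    using that assms(1) finite_subset by blast
  obtain u where u: "u \<in> R v" and least: "\<And>w. w \<in> R v \<Longrightarrow> card (R u) \<le> card (R w)"
    using ex_has_least_nat[of "\<lambda>w. w \<in> R v" v "\<lambda>w. card (R w)"] by (auto simp: R_def)
  have uV: "u \<in> V" using RV[OF assms(3)] u by blast
  have self: "u \<in> R u" by (simp add: R_def)
  have up: "(w, u) \<in> E\<^sup>*" if "w \<in> R u" for w
  proof -
    have sub: "R w \<subseteq> R u" using that by (auto simp: R_def intro: rtrancl_trans)
    have "w \<in> R v" using that u by (auto simp: R_def intro: rtrancl_trans)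
    then have "R w = R u" using sub least fin[OF uV] by (intro card_seteq)
    then show ?thesis using self by (auto simp: R_def)
  qed
  have closed: "w' \<in> R u" if "w \<in> R u" "(w, w') \<in> E\<^sup>*" for w w'
    using that by (auto simp: R_def intro: rtrancl_trans)
  have "essential_class V E (R u)"
    unfolding essential_class_def
  proof (intro conjI allI impI ballI)
    show "R u \<noteq> {}" using self by blast
    show "R u \<subseteq> V" by (rule RV[OF uV])
    show "joined_inside E (R u)"
      unfolding joined_inside_def
    proof (intro ballI)
      fix x y
      assume "x \<in> R u" "y \<in> R u"
      moreover from this have "(x, y) \<in> E\<^sup>*"
        using up[of x] by (auto simp: R_def intro: rtrancl_trans)
      ultimately show "(x, y) \<in> (E \<inter> R u \<times> R u)\<^sup>*"
        using rtrancl_inside_closed closed by metis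
    qed
  next
    fix C'
    assume C': "R u \<subseteq> C' \<and> C' \<subseteq> V \<and> joined_inside E C'"
    show "C' = R u"
    proof
      show "C' \<subseteq> R u"
      proof
        fix x
        assume "x \<in> C'"
        then have "(u, x) \<in> (E \<inter> C' \<times> C')\<^sup>*"
          using C' self unfolding joined_inside_def by blast
        then have "(u, x) \<in> E\<^sup>*" by (rule rtrancl_mono[THEN subsetD, rotated]) auto
        then show "x \<in> R u" by (simp add: R_def)
      qed
    qed (use C' in blast)
  qed (use closed in blast)
  moreover have "(v, u) \<in> E\<^sup>*" using u by (simp add: R_def)
  ultimately show ?thesis using self by blast
qed


section \<open>Quasi-multiplicative sequences\<close>

text \<open>Fekete's argument from both sides: \<open>lo * N\<close> is supermultiplicative and
  \<open>hi * N\<close> submultiplicative, so comparing both at length \<open>m * l\<close> puts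
  every \<open>ln (lo * N m) / m\<close> below every \<open>ln (hi * N l) / l\<close>. Any
  \<open>h\<close> between the two families satisfies both bounds.\<close>

lemma quasi_multiplicative_growth:
  fixes N :: "nat \<Rightarrow> real" and lo hi :: real
  assumes lo: "0 < lo" and pos: "\<And>m. 1 \<le> N m"
    and lower: "\<And>m l. lo * N m * N l \<le> N (m + l)"
    and upper: "\<And>m l. N (m + l) \<le> hi * N m * N l"
    and N0: "N 0 = 1"
  shows "\<exists>h\<ge>0. \<forall>m. lo * N m \<le> exp (h * real m) \<and> exp (h * real m) \<le> hi * N m"
proof -
  have lo1: "lo \<le> 1" and hi1: "1 \<le> hi" using lower[of 0 0] upper[of 0 0] N0 by auto
  have Npos: "0 < N m" for m using pos[of m] by linarith
  have low_pow: "(lo * N m) ^ l \<le> lo * N (m * l)" if "l > 0" for m l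
    using that
  proof (induction l rule: nat_induct_non_zero)
    case (Suc l)
    have "(lo * N m) ^ Suc l \<le> lo * N m * (lo * N (m * l))"
      using Suc lo Npos[of m] by (simp add: mult_left_mono)
    also have "\<dots> = lo * (lo * N m * N (m * l))" by simp
    also have "\<dots> \<le> lo * N (m * Suc l)"
      using lower[of m "m * l"] lo by (intro mult_left_mono) auto
    finally show ?case .
  qed simp
  have up_pow: "hi * N (m * l) \<le> (hi * N m) ^ l" if "l > 0" for m l
    using that
  proof (induction l rule: nat_induct_non_zero)
    case (Suc l)
    have "hi * N (m * Suc l) \<le> hi * (hi * N m * N (m * l))"
      using upper[of m "m * l"] hi1 by (intro mult_left_mono) auto
    also have "\<dots> = (hi * N m) * (hi * N (m * l))" by simp
    also have "\<dots> \<le> (hi * N m) ^ Suc l"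
      using Suc hi1 Npos[of m] by (simp add: mult_left_mono)
    finally show ?case .
  qed simp
  define f g where "f m = ln (lo * N m) / real m" and "g m = ln (hi * N m) / real m" for m
  have fg: "f m \<le> g l" if "m > 0" "l > 0" for m l
  proof -
    have "(lo * N m) ^ l \<le> lo * N (m * l)" by (rule low_pow[OF that(2)])
    also have "\<dots> \<le> hi * N (l * m)"
      using lo1 hi1 Npos[of "m * l"] by (simp add: mult.commute mult_right_mono)
    also have "\<dots> \<le> (hi * N l) ^ m" by (rule up_pow[OF that(1)])
    finally have "ln ((lo * N m) ^ l) \<le> ln ((hi * N l) ^ m)"
      using lo Npos[of m] by (intro ln_mono) auto
    then have "real l * ln (lo * N m) \<le> real m * ln (hi * N l)"
      using lo hi1 Npos[of m] Npos[of l] by (simp add: ln_realpow)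
    then show ?thesis using that by (simp add: f_def g_def field_simps)
  qed
  define h where "h = (SUP m\<in>{0<..}. f m)"
  have bdd: "bdd_above (f ` {0<..})" using fg[of _ 1] by (intro bdd_aboveI2[of _ _ "g 1"]) auto
  have fh: "f m \<le> h" if "m > 0" for m
    unfolding h_def using that by (intro cSUP_upper bdd) auto
  have hg: "h \<le> g m" if "m > 0" for m
    unfolding h_def using that fg by (intro cSUP_least) auto
  have main: "lo * N m \<le> exp (h * real m) \<and> exp (h * real m) \<le> hi * N m" for m
  proof (cases "m = 0")
    case True
    then show ?thesis using N0 lo1 hi1 by simp
  next
    case False
    then have "ln (lo * N m) \<le> h * real m" "h * real m \<le> ln (hi * N m)"
      using fh[of m] hg[of m] by (auto simp: f_def g_def field_simps)
    moreover have "0 < lo * N m" "0 < hi * N m" using lo hi1 Npos[of m] by auto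
    ultimately show ?thesis by (metis exp_le_cancel_iff exp_ln)
  qed
  \<comment> \<open>A negative \<open>h\<close> would push \<open>exp (h * m)\<close> below
    \<open>lo\<close>, although \<open>N m\<close> is at least 1.\<close>
  have "h \<ge> 0"
  proof (rule ccontr)
    assume "\<not> h \<ge> 0"
    then obtain m where m: "real m * (- h) > - ln lo"
      using reals_Archimedean3[of "- h"] by (metis linorder_not_le neg_0_less_iff_less)
    have "lo \<le> lo * N m" using lo pos[of m] by simp
    also have "\<dots> \<le> exp (h * real m)" using main by blast
    finally have "ln lo \<le> h * real m" using lo by (metis ln_exp ln_mono)
    with m show False by (simp add: algebra_simps)
  qed
  with main show ?thesis by blast
qed


section \<open>Counting words of a homogeneous automaton\<close>

text \<open>An abstract form of the DFA, with \<open>dead\<close> in place of the empty set of NDFA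
  states. \<open>lower\<close> and \<open>upper\<close> express homogeneity; \<open>acc\<close> and
  \<open>E\<close> are parameters tied down by equations so that an instance can supply its own
  constants.\<close>

locale homogeneous_automaton =
  fixes step :: "'s \<Rightarrow> 'a \<Rightarrow> 's" and dead s0 :: 's and V :: "'s set" and lo hi :: real
    and acc :: "nat \<Rightarrow> 's \<Rightarrow> 'a list set" and E :: "('s \<times> 's) set"
  assumes dead_step: "step dead a = dead"
    and finite_V: "finite V" and s0_V: "s0 \<in> V" and dead_V: "dead \<notin> V"
    and step_V: "s \<in> V \<Longrightarrow> step s a \<noteq> dead \<Longrightarrow> step s a \<in> V"
    and acc_def: "acc m s = {w. length w = m \<and> foldl step s w \<noteq> dead}"
    and E_def: "E = {(s, t). s \<in> V \<and> t \<noteq> dead \<and> (\<exists>a. t = step s a)}"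
    and finite_acc: "s \<in> V \<Longrightarrow> finite (acc m s)"
    and live_s0: "acc m s0 \<noteq> {}"
    and lo_pos: "0 < lo"
    and lower: "s \<in> V \<Longrightarrow> lo * real (card (acc m s0)) \<le> real (card (acc m s))"
    and upper: "s \<in> V \<Longrightarrow> real (card (acc m s)) \<le> hi * real (card (acc m s0))"
begin

abbreviation run :: "'s \<Rightarrow> 'a list \<Rightarrow> 's" where "run \<equiv> foldl step"

definition N :: "nat \<Rightarrow> real" where "N m = real (card (acc m s0))"

lemma run_dead [simp]: "run dead w = dead"
  by (induction w) (auto simp: dead_step)

lemma run_V: "s \<in> V \<Longrightarrow> run s w \<noteq> dead \<Longrightarrow> run s w \<in> V"
proof (induction w arbitrary: s)
  case (Cons a w)
  then have "step s a \<noteq> dead" using run_dead by (metis foldl_Cons)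
  with Cons step_V show ?case by simp
qed simp

lemma acc_run_V: "s \<in> V \<Longrightarrow> w \<in> acc m s \<Longrightarrow> run s w \<in> V"
  using run_V by (auto simp: acc_def)

lemma acc_0: "s \<in> V \<Longrightarrow> acc 0 s = {[]}"
  using dead_V by (auto simp: acc_def)

lemma append_in_acc:
  "length u = m \<Longrightarrow> u @ v \<in> acc (m + l) s \<longleftrightarrow> u \<in> acc m s \<and> v \<in> acc l (run s u)"
  using run_dead[of v] by (auto simp: acc_def simp del: run_dead)

lemma take_acc: "w \<in> acc (m + l) s \<Longrightarrow> take m w \<in> acc m s"
  using append_in_acc[of "take m w" m "drop m w" l s] by (auto simp: acc_def)

lemma acc_split:
  "{w \<in> acc (m + l) s. take m w \<in> A} = (\<lambda>(u, v). u @ v) ` (SIGMA u:A \<inter> acc m s. acc l (run s u))"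
proof (intro equalityI subsetI)
  fix w
  assume "w \<in> {w \<in> acc (m + l) s. take m w \<in> A}"
  moreover have "w = (\<lambda>(u, v). u @ v) (take m w, drop m w)" by simp
  ultimately show "w \<in> (\<lambda>(u, v). u @ v) ` (SIGMA u:A \<inter> acc m s. acc l (run s u))"
    using append_in_acc[of "take m w" m "drop m w" l s]
    by (intro rev_image_eqI[of "(take m w, drop m w)"]) (auto simp: acc_def)
qed (auto simp: acc_def)

lemma card_acc_split:
  assumes "s \<in> V"
  shows "card {w \<in> acc (m + l) s. take m w \<in> A} = (\<Sum>u\<in>A \<inter> acc m s. card (acc l (run s u)))"
proof -
  have inj: "inj_on (\<lambda>(u, v). u @ v) (SIGMA u:A \<inter> acc m s. acc l (run s u))"
    by (auto simp: inj_on_def acc_def)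
  have "finite (A \<inter> acc m s)" using finite_acc[OF assms] by blast
  moreover have "finite (acc l (run s u))" if "u \<in> A \<inter> acc m s" for u
    using that finite_acc acc_run_V[OF assms] by blast
  ultimately show ?thesis unfolding acc_split card_image[OF inj] by (intro card_SigmaI) auto
qed

text \<open>Whatever state a prefix leads to, it has between \<open>lo * N l\<close> and
  \<open>hi * N l\<close> continuations. Quasi-multiplicativity of \<open>N\<close>, the weights of
  cylinders and the decay of bad words all come from this.\<close>

lemma card_acc_split_bounds:
  assumes "s \<in> V"
  shows "real (card (A \<inter> acc m s)) * (lo * N l) \<le> real (card {w \<in> acc (m + l) s. take m w \<in> A})"
    and "real (card {w \<in> acc (m + l) s. take m w \<in> A}) \<le> real (card (A \<inter> acc m s)) * (hi * N l)"
proof -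
  have b: "lo * N l \<le> real (card (acc l (run s u)))" "real (card (acc l (run s u))) \<le> hi * N l"
    if "u \<in> A \<inter> acc m s" for u
    using that lower upper acc_run_V[OF assms] by (auto simp: N_def)
  show "real (card (A \<inter> acc m s)) * (lo * N l) \<le> real (card {w \<in> acc (m + l) s. take m w \<in> A})"
    unfolding card_acc_split[OF assms] of_nat_sum using b(1) by (rule sum_bounded_below)
  show "real (card {w \<in> acc (m + l) s. take m w \<in> A}) \<le> real (card (A \<inter> acc m s)) * (hi * N l)"
    unfolding card_acc_split[OF assms] of_nat_sum using b(2) by (rule sum_bounded_above)
qed

lemma N_0: "N 0 = 1"
  by (simp add: N_def acc_0 s0_V)

lemma lo_le_1: "lo \<le> 1" and hi_ge_1: "1 \<le> hi"
  using lower[OF s0_V, of 0] upper[OF s0_V, of 0] by (simp_all add: acc_0 s0_V)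

lemma N_bounds: "lo * N m * N l \<le> N (m + l)" "N (m + l) \<le> hi * N m * N l"
  using card_acc_split_bounds[OF s0_V, where A = UNIV and m = m and l = l]
  by (simp_all add: N_def mult_ac)

lemma N_ge_1: "1 \<le> N m"
  using live_s0 finite_acc[OF s0_V] by (simp add: N_def Suc_leI card_gt_0_iff)

lemma growth: "\<exists>h\<ge>0. \<forall>m. lo * N m \<le> exp (h * real m) \<and> exp (h * real m) \<le> hi * N m"
  by (rule quasi_multiplicative_growth[OF lo_pos N_ge_1 N_bounds N_0])

lemma live: "s \<in> V \<Longrightarrow> acc m s \<noteq> {}"
proof
  assume s: "s \<in> V" "acc m s = {}"
  then have "lo * N m \<le> 0" using lower[OF s(1), of m] by (simp add: N_def)
  moreover have "0 < lo * N m" using lo_pos N_ge_1[of m] by (intro mult_pos_pos) auto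
  ultimately show False by simp
qed

text \<open>The uniform count on readable words of length \<open>M\<close> acts as a mass
  distribution: there are at least \<open>exp (h * M) / hi\<close> words, and a cylinder of length
  \<open>l\<close> holds at most \<open>hi / lo * exp (h * (M - l))\<close> of them. The quotient of
  the constants is \<open>lo / hi\<^sup>2\<close>, independent of \<open>M\<close>.\<close>

lemma cylinder_cover:
  fixes h :: real and w :: "'i \<Rightarrow> 'a list"
  assumes h: "\<And>m. lo * N m \<le> exp (h * real m) \<and> exp (h * real m) \<le> hi * N m"
    and I: "finite I" "\<And>i. i \<in> I \<Longrightarrow> length (w i) \<le> M"
    and cover: "\<And>v. v \<in> acc M s0 \<Longrightarrow> \<exists>i\<in>I. take (length (w i)) v = w i"
  shows "lo / hi\<^sup>2 \<le> (\<Sum>i\<in>I. exp (- h * real (length (w i))))"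
proof -
  define A where "A i = {v \<in> acc (length (w i) + (M - length (w i))) s0. take (length (w i)) v \<in> {w i}}" for i
  have fin: "finite (A i)" for i
    unfolding A_def using finite_acc[OF s0_V] by simp
  have "acc M s0 \<subseteq> (\<Union>i\<in>I. A i)" using cover I(2) by (auto simp: A_def)
  then have "card (acc M s0) \<le> card (\<Union>i\<in>I. A i)" using I(1) fin by (intro card_mono) auto
  also have "\<dots> \<le> (\<Sum>i\<in>I. card (A i))" by (rule card_UN_le[OF I(1)])
  finally have "N M \<le> (\<Sum>i\<in>I. real (card (A i)))" by (simp add: N_def flip: of_nat_sum)
  also have "\<dots> \<le> (\<Sum>i\<in>I. hi / lo * (exp (h * real M) * exp (- h * real (length (w i)))))"
  proof (rule sum_mono)
    fix i
    assume i: "i \<in> I"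
    let ?l = "length (w i)"
    have c1: "card ({w i} \<inter> acc ?l s0) \<le> card {w i}" by (intro card_mono) auto
    have "real (card (A i)) \<le> real (card ({w i} \<inter> acc ?l s0)) * (hi * N (M - ?l))"
      unfolding A_def by (rule card_acc_split_bounds(2)[OF s0_V])
    also have "\<dots> \<le> 1 * (hi * N (M - ?l))"
      using c1 hi_ge_1 N_ge_1[of "M - ?l"] by (intro mult_right_mono) auto
    also have "\<dots> \<le> hi / lo * exp (h * real (M - ?l))"
      using h[of "M - ?l"] lo_pos hi_ge_1 by (simp add: field_simps)
    also have "exp (h * real (M - ?l)) = exp (h * real M) * exp (- h * real ?l)"
      using I(2)[OF i] by (simp add: of_nat_diff algebra_simps flip: exp_add)
    finally show "real (card (A i)) \<le> hi / lo * (exp (h * real M) * exp (- h * real ?l))" .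
  qed
  also have "\<dots> = exp (h * real M) * (hi / lo * (\<Sum>i\<in>I. exp (- h * real (length (w i)))))"
    by (simp add: sum_distrib_left mult_ac)
  finally have "N M \<le> exp (h * real M) * (hi / lo * (\<Sum>i\<in>I. exp (- h * real (length (w i)))))" .
  moreover have "exp (h * real M) * (1 / hi) \<le> N M" using h[of M] hi_ge_1 by (simp add: field_simps)
  ultimately have "exp (h * real M) * (1 / hi)
      \<le> exp (h * real M) * (hi / lo * (\<Sum>i\<in>I. exp (- h * real (length (w i)))))"
    by linarith
  then have "1 / hi \<le> hi / lo * (\<Sum>i\<in>I. exp (- h * real (length (w i))))"
    by (subst (asm) mult_le_cancel_left_pos) auto
  then show ?thesis using lo_pos hi_ge_1 by (simp add: field_simps power2_eq_square)
qed

section \<open>Words that stay outside the essential classes\<close>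

definition Bad :: "'s set" where
  "Bad = {s \<in> V. \<forall>C. essential_class V E C \<longrightarrow> s \<notin> C}"

lemma run_reachable:
  assumes "s \<in> V" "run s w \<noteq> dead"
  shows "(s, run s w) \<in> E\<^sup>*"
  using assms
proof (induction w rule: rev_induct)
  case (snoc a w)
  then have "run s w \<noteq> dead" using dead_step by (metis foldl_Cons foldl_Nil foldl_append)
  then have "(s, run s w) \<in> E\<^sup>*" "(run s w, run s (w @ [a])) \<in> E"
    using snoc run_V[of s w] by (auto simp: E_def)
  then show ?case by (rule rtrancl_into_rtrancl)
qed simp

lemma reachable_run:
  assumes "(s, t) \<in> E\<^sup>*"
  shows "\<exists>w. run s w = t"
  using assms
proof induction
  case base
  show ?case by (rule exI[of _ "[]"]) simp
next
  case (step y z)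
  then obtain w a where "run s w = y" "z = step y a" by (auto simp: E_def)
  then have "run s (w @ [a]) = z" by simp
  then show ?case by blast
qed

text \<open>Essential classes are closed under edges, so a run that has entered one cannot be in
  \<open>Bad\<close> later.\<close>

lemma Bad_prefix:
  assumes "s \<in> V" "run s (u @ v) \<in> Bad"
  shows "run s u \<in> Bad"
proof -
  have nd: "run (run s u) v \<noteq> dead" using assms dead_V by (auto simp: Bad_def)
  then have u: "run s u \<noteq> dead" using run_dead by metis
  then have uV: "run s u \<in> V" using assms(1) run_V by blast
  have "(run s u, run s (u @ v)) \<in> E\<^sup>*" using run_reachable[OF uV nd] by simp
  then have "run s (u @ v) \<in> C" if "essential_class V E C" "run s u \<in> C" for C
    using that by (auto simp: essential_class_def)
  then show ?thesis using assms(2) uV unfolding Bad_def by blast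
qed

text \<open>An exit word into an essential class can be prolonged by any live continuation, since
  the class is closed. So each state has exits of all sufficiently large lengths, and finiteness of
  \<open>V\<close> gives one length for all.\<close>

lemma uniform_exit: "\<exists>r\<ge>1. \<forall>s\<in>V. \<exists>w\<in>acc r s. run s w \<notin> Bad"
proof -
  have "\<exists>l0. \<forall>l\<ge>l0. \<exists>w\<in>acc l s. run s w \<notin> Bad" if s: "s \<in> V" for s
  proof -
    have "E \<subseteq> V \<times> V" using step_V by (auto simp: E_def)
    then obtain C u where C: "essential_class V E C" "u \<in> C" "(s, u) \<in> E\<^sup>*"
      using exists_reachable_essential_class[OF finite_V _ s] by blast
    then have u: "u \<in> V" by (auto simp: essential_class_def)
    obtain w where w: "run s w = u" using reachable_run C(3) by blast
    have "\<exists>w'\<in>acc l s. run s w' \<notin> Bad" if l: "length w \<le> l" for l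
    proof -
      obtain v where v: "v \<in> acc (l - length w) u" using live[OF u] by blast
      then have "(u, run u v) \<in> E\<^sup>*" using run_reachable[OF u] by (auto simp: acc_def)
      then have "run s (w @ v) \<in> C" using C w by (auto simp: essential_class_def)
      then have "run s (w @ v) \<notin> Bad" using C(1) by (auto simp: Bad_def)
      moreover have "w @ v \<in> acc l s" using v w l by (auto simp: acc_def)
      ultimately show ?thesis by blast
    qed
    then show ?thesis by blast
  qed
  then obtain l0 where l0: "\<And>s l. s \<in> V \<Longrightarrow> l0 s \<le> l \<Longrightarrow> \<exists>w\<in>acc l s. run s w \<notin> Bad" by metis
  \<comment> \<open>The sum stands in for a maximum over \<open>V\<close>; the successor secures
    \<open>r \<ge> 1\<close>.\<close>
  have "l0 s \<le> Suc (\<Sum>s\<in>V. l0 s)" if "s \<in> V" for s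
    using member_le_sum[OF that, of l0] finite_V by simp
  then show ?thesis using l0 by (intro exI[of _ "Suc (\<Sum>s\<in>V. l0 s)"]) auto
qed

definition bad_words :: "nat \<Rightarrow> 'a list set" where
  "bad_words m = {w \<in> acc m s0. run s0 w \<in> Bad}"

text \<open>The prefix is bad, the tail of length \<open>l\<close> is arbitrary. Counting bad words
  of length \<open>m + r\<close> directly against those of length \<open>m\<close> could cost a
  factor such as \<open>hi / lo\<close> in each round; with the total length kept fixed, successive
  sets are nested and a proportion is removed.\<close>

definition bad_prefix_words :: "nat \<Rightarrow> nat \<Rightarrow> 'a list set" where
  "bad_prefix_words m l = {w \<in> acc (m + l) s0. take m w \<in> bad_words m}"

text \<open>Following each bad word by an exit word of length \<open>r\<close> produces the words that are lost.\<close>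

lemma bad_prefix_words_decay:
  assumes exit: "\<And>s. s \<in> V \<Longrightarrow> \<exists>w\<in>acc r s. run s w \<notin> Bad"
  shows "real (card (bad_prefix_words (m + r) l))
    \<le> (1 - lo / (hi\<^sup>2 * N r)) * real (card (bad_prefix_words m (r + l)))"
proof -
  let ?T = "bad_prefix_words m (r + l)"
  obtain e where e: "\<And>s. s \<in> V \<Longrightarrow> e s \<in> acc r s \<and> run s (e s) \<notin> Bad" using exit by metis
  \<comment> \<open>One exit word per bad \<open>u\<close>, chosen according to the state that
    \<open>u\<close> reaches. The words in \<open>X\<close> that continue these still belong to
    \<open>?T\<close>, but have left \<open>Bad\<close> at length \<open>m + r\<close>.\<close>
  define A where "A = (\<lambda>u. u @ e (run s0 u)) ` bad_words m"
  define X where "X = {w \<in> acc ((m + r) + l) s0. take (m + r) w \<in> A}"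
  have bw: "u \<in> acc m s0" "length u = m" "run s0 u \<in> V" if "u \<in> bad_words m" for u
    using that by (auto simp: bad_words_def acc_def Bad_def)
  have Aacc: "A \<subseteq> acc (m + r) s0"
    using bw e by (auto simp: A_def append_in_acc)
  have "inj_on (\<lambda>u. u @ e (run s0 u)) (bad_words m)"
    using bw by (auto simp: inj_on_def)
  then have cardA: "card A = card (bad_words m)" unfolding A_def by (rule card_image)
  have finT: "finite ?T" using finite_acc[OF s0_V] by (auto simp: bad_prefix_words_def)
  have XT: "X \<subseteq> ?T"
  proof
    fix w
    assume "w \<in> X"
    then obtain u where u: "u \<in> bad_words m" "take (m + r) w = u @ e (run s0 u)" "w \<in> acc (m + r + l) s0"
      by (auto simp: X_def A_def)
    have "take m w = take m (take (m + r) w)" by simp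
    also have "\<dots> = u" using u bw by simp
    finally show "w \<in> ?T" using u by (simp add: bad_prefix_words_def add.assoc)
  qed
  have "bad_prefix_words (m + r) l \<subseteq> ?T - X"
  proof
    fix w
    assume w: "w \<in> bad_prefix_words (m + r) l"
    then have w1: "w \<in> acc (m + r + l) s0" and w2: "take (m + r) w \<in> bad_words (m + r)"
      by (auto simp: bad_prefix_words_def)
    have tk: "take (m + r) w = take m w @ take r (drop m w)" by (simp add: take_add)
    have "run s0 (take m w) \<in> Bad"
      using w2 Bad_prefix[OF s0_V] unfolding tk bad_words_def by blast
    then have "take m w \<in> bad_words m"
      using take_acc[of w m "r + l" s0] w1 by (simp add: bad_words_def add.assoc)
    moreover have "take (m + r) w \<notin> A"
    proof
      assume "take (m + r) w \<in> A"
      then obtain u where "u \<in> bad_words m" "take (m + r) w = u @ e (run s0 u)" by (auto simp: A_def)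
      then have "run s0 (u @ e (run s0 u)) \<in> Bad" "run (run s0 u) (e (run s0 u)) \<notin> Bad"
        using w2 e bw(3) by (auto simp: bad_words_def)
      then show False by simp
    qed
    ultimately show "w \<in> ?T - X" using w1 by (auto simp: bad_prefix_words_def X_def add.assoc)
  qed
  then have "card (bad_prefix_words (m + r) l) \<le> card (?T - X)"
    using finT by (intro card_mono) auto
  also have "\<dots> = card ?T - card X" using XT finT by (intro card_Diff_subset) (auto intro: finite_subset)
  finally have le: "real (card (bad_prefix_words (m + r) l)) \<le> real (card ?T) - real (card X)"
    using card_mono[OF finT XT] by linarith
  have Npos: "0 < N j" for j using N_ge_1[of j] by linarith
  \<comment> \<open>\<open>X\<close> has at least \<open>lo * N l\<close> words per bad
    \<open>u\<close> and \<open>?T\<close> at most \<open>hi\<^sup>2 * N r * N l\<close>, whence the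
    proportion \<open>lo / (hi\<^sup>2 * N r)\<close>.\<close>
  have cX: "real (card (bad_words m)) * (lo * N l) \<le> real (card X)"
    using card_acc_split_bounds(1)[OF s0_V, of A "m + r" l] Aacc cardA by (simp add: X_def Int_absorb2)
  have "real (card ?T) \<le> real (card (bad_words m \<inter> acc m s0)) * (hi * N (r + l))"
    unfolding bad_prefix_words_def by (rule card_acc_split_bounds(2)[OF s0_V])
  also have "bad_words m \<inter> acc m s0 = bad_words m" by (auto simp: bad_words_def)
  also have "real (card (bad_words m)) * (hi * N (r + l))
      \<le> real (card (bad_words m)) * (hi * (hi * N r * N l))"
    using N_bounds(2)[of r l] hi_ge_1 by (intro mult_left_mono) auto
  finally have "lo / (hi\<^sup>2 * N r) * real (card ?T)
      \<le> lo / (hi\<^sup>2 * N r) * (real (card (bad_words m)) * (hi * (hi * N r * N l)))"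
    using lo_pos Npos[of r] by (intro mult_left_mono) auto
  also have "\<dots> = real (card (bad_words m)) * (lo * N l)"
    using hi_ge_1 Npos[of r] by (simp add: field_simps power2_eq_square)
  finally show ?thesis using cX le by (simp add: algebra_simps)
qed

lemma bad_words_decay: "\<exists>r\<ge>1. \<exists>\<theta>. 0 < \<theta> \<and> \<theta> < 1 \<and> (\<forall>j. real (card (bad_words (j * r))) \<le> \<theta> ^ j * N (j * r))"
proof -
  obtain r where r: "r \<ge> 1" "\<And>s. s \<in> V \<Longrightarrow> \<exists>w\<in>acc r s. run s w \<notin> Bad"
    using uniform_exit by blast
  define \<eta> where "\<eta> = lo / (hi\<^sup>2 * N r)"
  have "1 \<le> hi\<^sup>2 * N r" using hi_ge_1 N_ge_1[of r] mult_mono[of 1 "hi\<^sup>2" 1 "N r"] by simp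
  then have \<eta>: "0 < \<eta>" "\<eta> \<le> 1" using lo_pos lo_le_1 by (auto simp: \<eta>_def divide_le_eq)
  \<comment> \<open>\<open>\<eta>\<close> may equal 1; halving it keeps the ratio positive, so that
    its logarithm can be used later. The tail length stays free because each round moves
    \<open>r\<close> letters from the tail to the prefix.\<close>
  have *: "real (card (bad_prefix_words (j * r) l)) \<le> (1 - \<eta> / 2) ^ j * N (j * r + l)" for j l
  proof (induction j arbitrary: l)
    case 0
    have "card (bad_prefix_words 0 l) \<le> card (acc l s0)"
      using finite_acc[OF s0_V] by (intro card_mono) (auto simp: bad_prefix_words_def)
    then show ?case by (simp add: N_def)
  next
    case (Suc j)
    have "real (card (bad_prefix_words (Suc j * r) l))
        \<le> (1 - \<eta>) * real (card (bad_prefix_words (j * r) (r + l)))"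
      using bad_prefix_words_decay[of r "j * r" l] r(2) by (simp add: \<eta>_def add.commute)
    also have "\<dots> \<le> (1 - \<eta> / 2) * real (card (bad_prefix_words (j * r) (r + l)))"
      using \<eta> by (intro mult_right_mono) auto
    also have "\<dots> \<le> (1 - \<eta> / 2) * ((1 - \<eta> / 2) ^ j * N (j * r + (r + l)))"
      using \<eta> by (intro mult_left_mono Suc) auto
    also have "\<dots> = (1 - \<eta> / 2) ^ Suc j * N (Suc j * r + l)" by (simp add: ac_simps)
    finally show ?case .
  qed
  have "bad_prefix_words m 0 = bad_words m" for m
    by (auto simp: bad_prefix_words_def bad_words_def acc_def)
  then have "real (card (bad_words (j * r))) \<le> (1 - \<eta> / 2) ^ j * N (j * r)" for j
    using *[of j 0] by simp
  then show ?thesis using r(1) \<eta> by (intro exI[of _ r] conjI exI[of _ "1 - \<eta> / 2"]) auto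
qed

end


section \<open>Arithmetic of \<open>p\<close>-adic integers\<close>

text \<open>The residues modulo \<open>p^m\<close> are invertible because \<open>p\<close> does not
  divide them. Their inverses are unique modulo \<open>p^m\<close>, hence compatible for varying
  \<open>m\<close>, and so define a p-adic integer.\<close>

lemma padic_int_unit:
  fixes x :: "'p::prime_card padic_int"
  assumes "Rep_padic_int x 1 \<noteq> 0"
  shows "\<exists>y. x * y = 1"
proof -
  let ?p = "pp TYPE('p)"
  have pr: "prime ?p" by (rule prime_card_int)
  have cop: "coprime (Rep_padic_int x m) (?p ^ m)" for m
  proof (cases "m = 0")
    case False
    then have "Rep_padic_int x m mod ?p ^ 1 = Rep_padic_int x 1" by (intro Rep_padic_int_mod) simp
    then have "\<not> ?p dvd Rep_padic_int x m" using assms by (simp add: dvd_eq_mod_eq_0)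
    then show ?thesis
      using pr by (metis coprime_commute coprime_power_left_iff prime_imp_coprime)
  qed simp
  then have "\<exists>g. [Rep_padic_int x m * g = 1] (mod ?p ^ m)" for m
    by (rule cong_solve_coprime_int)
  then obtain g where g: "\<And>m. [Rep_padic_int x m * g m = 1] (mod ?p ^ m)" by metis
  define f where "f m = g m mod ?p ^ m" for m
  have f: "[Rep_padic_int x m * f m = 1] (mod ?p ^ m)" for m
    using g[of m] by (simp add: f_def cong_def mod_simps del: of_nat_power)
  have "f m \<in> {0..<?p ^ m} \<and> f (Suc m) mod ?p ^ m = f m" for m
  proof
    show "f m \<in> {0..<?p ^ m}" unfolding f_def by (rule pp_mod_range)
    have "[Rep_padic_int x (Suc m) * f (Suc m) = 1] (mod ?p ^ m)"
      using f[of "Suc m"] by (rule cong_dvd_modulus) simp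
    moreover have "[Rep_padic_int x (Suc m) = Rep_padic_int x m] (mod ?p ^ m)"
      using Rep_padic_int_Suc[of x m] Rep_padic_int_mod[of m m x] by (simp add: cong_def del: of_nat_power)
    ultimately have "[Rep_padic_int x m * f (Suc m) = 1] (mod ?p ^ m)"
      by (meson cong_scalar_right cong_sym cong_trans)
    then have "[Rep_padic_int x m * f (Suc m) = Rep_padic_int x m * f m] (mod ?p ^ m)"
      using f[of m] by (meson cong_sym cong_trans)
    then have "[f (Suc m) = f m] (mod ?p ^ m)"
      using cong_mult_lcancel[OF cop[of m]] by blast
    then show "f (Suc m) mod ?p ^ m = f m" by (simp add: cong_def f_def del: of_nat_power)
  qed
  then have R: "Rep_padic_int (Abs_padic_int f :: 'p padic_int) = f"
    by (intro Abs_padic_int_inverse) auto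
  have "Rep_padic_int (x * Abs_padic_int f) m = Rep_padic_int (1 :: 'p padic_int) m" for m
    using f[of m] by (simp add: times_padic_int.rep_eq one_padic_int.rep_eq R cong_def)
  then have "x * Abs_padic_int f = 1"
    by (simp only: Rep_padic_int_inject[symmetric] fun_eq_iff simp_thms)
  then show ?thesis by blast
qed

lemma Rep_padic_int_p_power_mult:
  "Rep_padic_int (of_nat CARD('p) ^ m * w :: 'p::prime_card padic_int) m = 0"
proof -
  have "Rep_padic_int (of_nat (CARD('p) ^ m) :: 'p padic_int) m = 0"
    unfolding Rep_padic_int_of_nat by simp
  then show ?thesis by (simp add: times_padic_int.rep_eq)
qed

text \<open>Dividing \<open>y\<close> by the exact power of \<open>p\<close> in it leaves a unit,
  since a further factor \<open>p\<close> would raise the valuation; that power also divides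
  \<open>x\<close>.\<close>

lemma padic_int_abs_dvd:
  fixes x y :: "'p::prime_card padic_int"
  assumes "padic_int_abs x \<le> padic_int_abs y"
  shows "y dvd x"
proof (cases "x = 0")
  case False
  then have "padic_int_abs x > 0" by (metis padic_int_abs_eq_0 padic_int_abs_nonneg order_le_less)
  then have y0: "y \<noteq> 0" using assms by (auto simp: padic_int_abs_def[of 0])
  let ?v = "padic_int_val y"
  have p1: "(1::real) < real CARD('p)" using pp_gt_1[where 'p='p] by simp
  have "(1 / real CARD('p)) ^ padic_int_val x \<le> (1 / real CARD('p)) ^ ?v"
    using assms False y0 by (simp add: padic_int_abs_def)
  then have "?v \<le> padic_int_val x"
    using p1 by (subst (asm) power_decreasing_iff) auto
  then obtain x' where x': "x = of_nat CARD('p) ^ ?v * x'"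
    using padic_int_dvd_power padic_int_val_iff[OF False] by blast
  obtain u where u: "y = of_nat CARD('p) ^ ?v * u"
    using padic_int_dvd_power padic_int_val_iff[OF y0] by blast
  have "Rep_padic_int u 1 \<noteq> 0"
  proof
    assume "Rep_padic_int u 1 = 0"
    then obtain u' where "u = of_nat CARD('p) ^ 1 * u'" using padic_int_dvd_power by blast
    then have y: "y = of_nat CARD('p) ^ Suc ?v * u'" using u by (simp add: mult_ac)
    have "Rep_padic_int y (Suc ?v) = 0"
      by (subst y) (rule Rep_padic_int_p_power_mult)
    then show False using padic_int_val_iff[OF y0, of "Suc ?v"] by simp
  qed
  then obtain w where "u * w = 1" using padic_int_unit by blast
  then have "x = y * (w * x')" using x' by (subst u) (simp add: mult_ac)
  then show ?thesis by (rule dvdI)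
qed simp

text \<open>Allows membership to be proved by norm estimates, as for the points of \<open>K\<close>
  and for quotients by powers of \<open>p\<close>.\<close>

lemma padic_ints_iff_abs: "x \<in> padic_ints \<longleftrightarrow> padic_abs x \<le> 1"
proof
  assume "x \<in> padic_ints"
  then obtain X where "x = padic_of_int X" by (auto simp: padic_ints_def)
  then show "padic_abs x \<le> 1"
    by (auto simp: padic_abs_of_int padic_int_abs_def intro!: power_le_one)
next
  assume x: "padic_abs x \<le> 1"
  obtain a b where ab: "Rep_padic x = Fract a b" "b \<noteq> 0" by (cases "Rep_padic x")
  then have "padic_int_abs a / padic_int_abs b \<le> 1"
    using x by (simp add: padic_abs.rep_eq fract_abs_Fract)
  moreover have "padic_int_abs b > 0"
    using ab(2) by (metis padic_int_abs_eq_0 padic_int_abs_nonneg order_le_less)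
  ultimately have "b dvd a" by (intro padic_int_abs_dvd) (simp add: divide_le_eq)
  then obtain c where "a = b * c" by (rule dvdE)
  then have "Rep_padic x = Fract c 1" using ab by (simp add: eq_fract)
  then have "x = padic_of_int c" by (metis Rep_padic_inverse padic_of_int_def)
  then show "x \<in> padic_ints" by (simp add: padic_ints_def)
qed

lemma padic_ints_add: "x \<in> padic_ints \<Longrightarrow> y \<in> padic_ints \<Longrightarrow> x + y \<in> padic_ints"
  by (auto simp: padic_ints_def simp flip: padic_of_int_add)

lemma padic_ints_diff: "x \<in> padic_ints \<Longrightarrow> y \<in> padic_ints \<Longrightarrow> x - y \<in> padic_ints"
  by (auto simp: padic_ints_def simp flip: padic_of_int_diff)

lemma padic_ints_mult: "x \<in> padic_ints \<Longrightarrow> y \<in> padic_ints \<Longrightarrow> x * y \<in> padic_ints"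
  by (auto simp: padic_ints_def simp flip: padic_of_int_mult)

lemma padic_ints_of_nat: "of_nat m \<in> padic_ints"
  by (simp add: padic_of_nat padic_ints_def)

lemma padic_of_int_of_int: "of_int z = padic_of_int (of_int z)"
proof (cases z rule: int_cases2)
  case (nonpos k)
  have "- padic_of_int x = padic_of_int (- x)" for x :: "'a padic_int"
    using padic_of_int_diff[of 0 x] by simp
  with nonpos show ?thesis by (simp add: padic_of_nat)
qed (simp add: padic_of_nat)

lemma padic_ints_of_int: "of_int z \<in> padic_ints"
  by (simp add: padic_of_int_of_int padic_ints_def)

lemma padic_abs_p_power: "padic_abs ((of_nat CARD('p) :: 'p::prime_card padic) ^ m) = 1 / real CARD('p) ^ m"
proof (induction m)
  case 0
  show ?case by (metis padic_abs_of_int padic_int_abs_1 padic_of_int_1 div_by_1 power_0)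
qed (simp add: padic_abs_mult padic_abs_p)

lemma CARD_prime_gt_1: "1 < CARD('p::prime_card)"
  using pp_gt_1[where 'p='p] by simp

section \<open>Residues, digits and distances\<close>

lemma padic_residue_unique:
  fixes z :: "'p::prime_card padic"
  assumes "r < CARD('p) ^ m" "z \<in> padic_ints" "x = of_nat r + of_nat CARD('p) ^ m * z"
  shows "padic_residue m x = r"
proof -
  let ?p = "pp TYPE('p)"
  obtain Z where Z: "z = padic_of_int Z" using assms(2) by (auto simp: padic_ints_def)
  define X where "X = of_nat r + of_nat (CARD('p) ^ m) * Z"
  have "x = padic_of_int X"
    by (simp add: assms(3) Z X_def padic_of_int_add padic_of_int_mult padic_p_power flip: padic_of_nat)
  moreover have "Rep_padic_int X m = int r mod ?p ^ m"
    by (simp add: X_def plus_padic_int.rep_eq times_padic_int.rep_eq Rep_padic_int_of_nat mod_simps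
        del: of_nat_power) simp
  moreover have "int r < ?p ^ m" using assms(1) by (metis of_nat_less_iff of_nat_power)
  ultimately show ?thesis by (simp add: padic_residue_padic_of_int del: of_nat_power)
qed

lemma padic_residue_decomp:
  fixes x :: "'p::prime_card padic"
  assumes "x \<in> padic_ints"
  shows "padic_residue m x < CARD('p) ^ m"
    and "\<exists>z\<in>padic_ints. x = of_nat (padic_residue m x) + of_nat CARD('p) ^ m * z"
proof -
  let ?p = "pp TYPE('p)"
  obtain X where X: "x = padic_of_int X" using assms by (auto simp: padic_ints_def)
  let ?r = "nat (Rep_padic_int X m)"
  have r: "int ?r = Rep_padic_int X m" "Rep_padic_int X m < ?p ^ m"
    using Rep_padic_int_range[of X m] by (simp_all del: of_nat_power)
  then have lt: "?r < CARD('p) ^ m" by (metis of_nat_less_iff of_nat_power)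
  have "Rep_padic_int (X - of_nat ?r) m = 0"
    unfolding minus_padic_int_def plus_padic_int.rep_eq uminus_padic_int.rep_eq
      Rep_padic_int_of_nat r by (simp add: mod_simps del: of_nat_power)
  then obtain z where "X - of_nat ?r = of_nat CARD('p) ^ m * z"
    using padic_int_dvd_power by blast
  then have "X = of_nat ?r + of_nat CARD('p) ^ m * z" by (simp add: algebra_simps)
  then have "x = of_nat ?r + of_nat CARD('p) ^ m * padic_of_int z"
    by (simp only: X padic_p_power padic_of_nat[of "nat _"] padic_of_int_add[symmetric] padic_of_int_mult[symmetric])
  moreover have "padic_residue m x = ?r" unfolding X by (rule padic_residue_padic_of_int)
  ultimately show "padic_residue m x < CARD('p) ^ m"
    and "\<exists>z\<in>padic_ints. x = of_nat (padic_residue m x) + of_nat CARD('p) ^ m * z"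
    using lt by (auto simp: padic_ints_def)
qed

lemma padic_residue_eq_iff_dist:
  fixes x y :: "'p::prime_card padic"
  assumes "x \<in> padic_ints" "y \<in> padic_ints"
  shows "padic_residue m x = padic_residue m y \<longleftrightarrow> dist x y \<le> 1 / real CARD('p) ^ m"
proof
  assume "padic_residue m x = padic_residue m y"
  then obtain z w :: "'p padic" where zw: "z \<in> padic_ints" "w \<in> padic_ints"
    and "x - y = of_nat CARD('p) ^ m * (z - w)"
    using padic_residue_decomp(2)[OF assms(1), of m] padic_residue_decomp(2)[OF assms(2), of m]
    by (auto simp: algebra_simps)
  then have "dist x y = 1 / real CARD('p) ^ m * padic_abs (z - w)"
    by (simp add: dist_padic_def padic_abs_mult padic_abs_p_power)
  also have "\<dots> \<le> 1 / real CARD('p) ^ m * 1"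
    using padic_ints_diff[OF zw] padic_ints_iff_abs by (intro mult_left_mono) auto
  finally show "dist x y \<le> 1 / real CARD('p) ^ m" by simp
next
  let ?q = "of_nat CARD('p) :: 'p padic"
  assume d: "dist x y \<le> 1 / real CARD('p) ^ m"
  have q0: "?q ^ m \<noteq> 0" by simp
  have "padic_abs ((x - y) / ?q ^ m) * padic_abs (?q ^ m) = padic_abs (x - y)"
    using q0 by (simp flip: padic_abs_mult)
  then have "padic_abs ((x - y) / ?q ^ m) = dist x y * real CARD('p) ^ m"
    by (simp add: padic_abs_p_power dist_padic_def field_simps)
  also have "\<dots> \<le> 1" using d by (simp add: field_simps)
  finally have int: "(x - y) / ?q ^ m \<in> padic_ints" by (simp add: padic_ints_iff_abs)
  obtain z where z: "z \<in> padic_ints" "y = of_nat (padic_residue m y) + ?q ^ m * z"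
    using padic_residue_decomp(2)[OF assms(2)] by blast
  have "x = y + ?q ^ m * ((x - y) / ?q ^ m)" using q0 by simp
  also have "\<dots> = of_nat (padic_residue m y) + ?q ^ m * z + ?q ^ m * ((x - y) / ?q ^ m)"
    by (simp flip: z(2))
  finally have "x = of_nat (padic_residue m y) + ?q ^ m * (z + (x - y) / ?q ^ m)"
    by (simp only: distrib_left add.assoc)
  then show "padic_residue m x = padic_residue m y"
    using padic_residue_unique padic_residue_decomp(1)[OF assms(2)] padic_ints_add[OF z(1) int] by blast
qed

lemma padic_residue_shift:
  fixes y :: "'p::prime_card padic"
  assumes "a < CARD('p)" "y \<in> padic_ints"
  shows "padic_residue (Suc m) (of_nat a + of_nat CARD('p) * y) = a + CARD('p) * padic_residue m y"
proof -
  obtain z where z: "z \<in> padic_ints" "y = of_nat (padic_residue m y) + of_nat CARD('p) ^ m * z"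
    using padic_residue_decomp(2)[OF assms(2)] by blast
  have "a + CARD('p) * padic_residue m y < CARD('p) * Suc (padic_residue m y)" using assms(1) by simp
  also have "\<dots> \<le> CARD('p) * CARD('p) ^ m"
    using padic_residue_decomp(1)[OF assms(2), of m] by (intro mult_le_mono2) auto
  finally show ?thesis
    by (intro padic_residue_unique[OF _ z(1)]) (simp, subst z(2), simp add: algebra_simps)
qed

lemma padic_digit_shift_0:
  assumes "a < CARD('p)" "y \<in> padic_ints"
  shows "padic_digit (of_nat a + of_nat CARD('p) * y :: 'p::prime_card padic) 0 = a"
proof -
  have "padic_residue 0 y = 0" using padic_residue_decomp(1)[OF assms(2), of 0] by simp
  then show ?thesis using padic_residue_shift[OF assms, of 0] by (simp add: padic_digit_def)
qed

lemma padic_digit_shift_Suc: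
  assumes "a < CARD('p)" "y \<in> padic_ints"
  shows "padic_digit (of_nat a + of_nat CARD('p) * y :: 'p::prime_card padic) (Suc j) = padic_digit y j"
  using assms(1) by (simp add: padic_digit_def padic_residue_shift[OF assms] div_mult2_eq)

lemma padic_int_shift_cases:
  fixes x :: "'p::prime_card padic"
  assumes "x \<in> padic_ints"
  obtains a y where "a < CARD('p)" "y \<in> padic_ints" "x = of_nat a + of_nat CARD('p) * y"
  using padic_residue_decomp[OF assms, of 1] that by auto

definition digits :: "nat \<Rightarrow> 'p::prime_card padic \<Rightarrow> nat list" where
  "digits m x = map (padic_digit x) [0..<m]"

lemma digits_0 [simp]: "digits 0 x = []"
  and length_digits [simp]: "length (digits m x) = m"
  by (simp_all add: digits_def)

lemma digits_Suc_snoc: "digits (Suc m) x = digits m x @ [padic_digit x m]"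
  by (simp add: digits_def)

lemma digits_shift:
  assumes "a < CARD('p)" "y \<in> padic_ints"
  shows "digits (Suc m) (of_nat a + of_nat CARD('p) * y :: 'p::prime_card padic) = a # digits m y"
  by (simp add: digits_def padic_digit_shift_0[OF assms] padic_digit_shift_Suc[OF assms]
      upt_conv_Cons map_Suc_upt[symmetric] del: upt_Suc)

lemma take_digits: "l \<le> m \<Longrightarrow> take l (digits m x) = digits l x"
  by (simp add: digits_def take_map)

lemma set_digits: "x \<in> padic_ints \<Longrightarrow> set (digits m x) \<subseteq> {..<CARD('p)}"
  for x :: "'p::prime_card padic"
proof (induction m arbitrary: x)
  case (Suc m)
  from Suc.prems show ?case
    by (cases rule: padic_int_shift_cases) (use Suc.IH in \<open>simp add: digits_shift\<close>)
qed simp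

text \<open>Digit cylinders of length \<open>m\<close> are the closed balls of radius
  \<open>p^(-m)\<close> in the p-adic integers; through this, metric covers become sets of
  words.\<close>

lemma digits_eq_iff_dist:
  fixes x y :: "'p::prime_card padic"
  assumes "x \<in> padic_ints" "y \<in> padic_ints"
  shows "digits m x = digits m y \<longleftrightarrow> dist x y \<le> 1 / real CARD('p) ^ m"
proof -
  have "digits m x = digits m y \<longleftrightarrow> padic_residue m x = padic_residue m y"
    using assms
  proof (induction m arbitrary: x y)
    case 0
    then show ?case
      using padic_residue_decomp(1)[of x 0] padic_residue_decomp(1)[of y 0] by simp
  next
    case (Suc m)
    obtain a x' where x: "a < CARD('p)" "x' \<in> padic_ints" "x = of_nat a + of_nat CARD('p) * x'"
      using Suc.prems(1) by (rule padic_int_shift_cases)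
    obtain b y' where y: "b < CARD('p)" "y' \<in> padic_ints" "y = of_nat b + of_nat CARD('p) * y'"
      using Suc.prems(2) by (rule padic_int_shift_cases)
    have "a + CARD('p) * r = b + CARD('p) * s \<longleftrightarrow> a = b \<and> r = s" for r s
    proof
      assume eq: "a + CARD('p) * r = b + CARD('p) * s"
      have "a = b" using arg_cong[OF eq, of "\<lambda>t. t mod CARD('p)"] x(1) y(1) by simp
      with eq show "a = b \<and> r = s" by simp
    qed simp
    then show ?case
      using Suc.IH[OF x(2) y(2)] by (simp add: x y digits_shift padic_residue_shift)
  qed
  then show ?thesis using padic_residue_eq_iff_dist[OF assms] by simp
qed

text \<open>Compare residues at level \<open>m\<close>, where the right-hand side gives 0. This
  keeps the numerators of transducer states integral over a fixed denominator.\<close>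

lemma of_int_eq_p_power_mult:
  fixes w :: "'p::prime_card padic"
  assumes "of_int y = of_nat CARD('p) ^ m * w" "w \<in> padic_ints"
  shows "int CARD('p) ^ m dvd y"
proof -
  obtain W where W: "w = padic_of_int W" using assms(2) by (auto simp: padic_ints_def)
  have "padic_of_int (of_int y) = padic_of_int (of_nat (CARD('p) ^ m) * W)"
    using assms(1) by (simp add: W padic_of_int_of_int[symmetric] padic_of_int_mult padic_p_power)
  then have eq: "of_int y = of_nat (CARD('p) ^ m) * W" by simp
  have "Rep_padic_int (of_int y :: 'p padic_int) m = y mod int CARD('p) ^ m"
  proof (cases y rule: int_cases2)
    case (nonneg k)
    then show ?thesis by (simp add: Rep_padic_int_of_nat)
  next
    case (nonpos k)
    then show ?thesis
      by (simp add: Rep_padic_int_of_nat uminus_padic_int.rep_eq mod_simps del: of_nat_power)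
  qed
  moreover have "Rep_padic_int (of_int y :: 'p padic_int) m = 0"
    unfolding eq of_nat_power by (rule Rep_padic_int_p_power_mult)
  ultimately show ?thesis by (simp add: dvd_eq_mod_eq_0)
qed


section \<open>The automata of a \<open>p\<close>-adic self-similar set\<close>

lemma padic_residue_mod:
  fixes v :: "'p::prime_card padic"
  assumes "v \<in> padic_ints" "j \<le> m"
  shows "padic_residue j v = padic_residue m v mod CARD('p) ^ j"
proof -
  let ?q = "of_nat CARD('p) :: 'p padic" and ?R = "padic_residue m v"
  obtain z where z: "z \<in> padic_ints" "v = of_nat ?R + ?q ^ m * z"
    using padic_residue_decomp(2)[OF assms(1)] by blast
  have "of_nat ?R = (of_nat (?R mod CARD('p) ^ j) :: 'p padic) + ?q ^ j * of_nat (?R div CARD('p) ^ j)"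
    by (metis mod_mult_div_eq of_nat_add of_nat_mult of_nat_power)
  moreover have "?q ^ m = ?q ^ j * ?q ^ (m - j)" using assms(2) by (simp flip: power_add)
  ultimately have "v = of_nat (?R mod CARD('p) ^ j) + ?q ^ j * (of_nat (?R div CARD('p) ^ j) + ?q ^ (m - j) * z)"
    by (subst z(2)) (simp add: algebra_simps)
  moreover have "of_nat (?R div CARD('p) ^ j) + ?q ^ (m - j) * z \<in> padic_ints"
    using z(1) by (metis padic_ints_add padic_ints_mult padic_ints_of_nat of_nat_power)
  moreover have "?R mod CARD('p) ^ j < CARD('p) ^ j" using CARD_prime_gt_1[where 'p='p] by simp
  ultimately show ?thesis by (metis padic_residue_unique)
qed

lemma finite_digits_image: "X \<subseteq> padic_ints \<Longrightarrow> finite (digits m ` X)" for X :: "'p::prime_card padic set"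
  using set_digits by (intro finite_subset[OF _ finite_lists_length_eq[of "{..<CARD('p)}" m]]) auto

lemma card_digits_add:
  fixes X :: "'p::prime_card padic set"
  assumes "X \<subseteq> padic_ints"
  shows "card (digits (m + l) ` X) \<le> CARD('p) ^ l * card (digits m ` X)"
proof -
  let ?W = "{w. set w \<subseteq> {..<CARD('p)} \<and> length w = l}"
  have "digits (m + l) ` X \<subseteq> (\<lambda>(u, v). u @ v) ` (digits m ` X \<times> ?W)"
  proof
    fix w
    assume "w \<in> digits (m + l) ` X"
    then obtain x where x: "x \<in> X" "w = digits (m + l) x" by blast
    then have "set (drop m w) \<subseteq> {..<CARD('p)}"
      using assms set_digits[of x "m + l"] by (meson order_trans set_drop_subset subsetD)
    moreover have "w = digits m x @ drop m w"
      using x take_digits[of m "m + l" x] by (metis append_take_drop_id le_add1)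
    ultimately show "w \<in> (\<lambda>(u, v). u @ v) ` (digits m ` X \<times> ?W)"
      using x by (intro rev_image_eqI[of "(digits m x, drop m w)"]) auto
  qed
  then have "card (digits (m + l) ` X) \<le> card ((\<lambda>(u, v). u @ v) ` (digits m ` X \<times> ?W))"
    using finite_digits_image[OF assms] finite_lists_length_eq[of "{..<CARD('p)}" l] by (intro card_mono) auto
  also have "\<dots> \<le> card (digits m ` X \<times> ?W)"
    using finite_digits_image[OF assms] finite_lists_length_eq[of "{..<CARD('p)}" l] by (intro card_image_le) auto
  also have "\<dots> = CARD('p) ^ l * card (digits m ` X)"
    using card_lists_length_eq[of "{..<CARD('p)}" l] by (simp add: card_cartesian_product mult.commute)
  finally show ?thesis .
qed

lemma padic_abs_sign [simp]: "padic_abs ((- 1) ^ m * x) = padic_abs x"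
  by (cases "even m") auto

lemma card_image_eq_if_same_fibers:
  assumes "\<And>x y. x \<in> A \<Longrightarrow> y \<in> A \<Longrightarrow> f x = f y \<longleftrightarrow> g x = g y"
  shows "card (f ` A) = card (g ` A)"
proof -
  define \<phi> where "\<phi> w = g (SOME x. x \<in> A \<and> f x = w)" for w
  have \<phi>: "\<phi> (f x) = g x" if "x \<in> A" for x
    unfolding \<phi>_def by (rule someI2[of _ x]) (use assms that in auto)
  have "inj_on \<phi> (f ` A)" using assms by (auto simp: inj_on_def \<phi>)
  moreover have "\<phi> ` f ` A = g ` A" by (auto simp: \<phi> image_image)
  ultimately show ?thesis using card_image by metis
qed

text \<open>The subset construction commutes with unions; this reduces counting from a DFA state to
  counting from single NDFA states.\<close>

lemma foldl_dfa_step_nonempty: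
  "foldl (dfa_step n b k d) S w \<noteq> {} \<longleftrightarrow> (\<exists>t\<in>S. foldl (dfa_step n b k d) {t} w \<noteq> {})"
proof -
  have "foldl (dfa_step n b k d) S w = (\<Union>t\<in>S. foldl (dfa_step n b k d) {t} w)" for S
  proof (induction w rule: rev_induct)
    case (snoc a w)
    have "dfa_step n b k d (foldl (dfa_step n b k d) S w) a
        = (\<Union>t\<in>S. dfa_step n b k d (foldl (dfa_step n b k d) {t} w) a)"
      by (subst snoc) (auto simp: dfa_step_def)
    then show ?case by simp
  qed simp
  from this[of S] show ?thesis by blast
qed

lemma dfa_run_eq_foldl: "dfa_run n b k d x j = foldl (dfa_step n b k d) {State (0, 1)} (digits j x)"
  by (induction j) (simp_all add: digits_Suc_snoc)

locale padic_ifs =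
  fixes n :: nat and b k :: "nat \<Rightarrow> nat" and d :: "nat \<Rightarrow> 'p::prime_card padic" and K :: "'p padic set"
  assumes k_pos: "i \<in> {1..n} \<Longrightarrow> 1 \<le> k i"
    and d_int: "i \<in> {1..n} \<Longrightarrow> d i \<in> padic_ints"
    and d_rat: "i \<in> {1..n} \<Longrightarrow> d i \<in> \<rat>"
    and self_similar: "is_self_similar_set n b k d K"
begin

abbreviation q :: "'p padic" where "q \<equiv> of_nat CARD('p)"
abbreviation TS :: "'p tstate set" where "TS \<equiv> transducer_states n b k d"
abbreviation val :: "'p tstate \<Rightarrow> nat \<Rightarrow> 'p padic" where "val \<equiv> transducer_value d"
abbreviation nxt :: "'p tstate \<Rightarrow> nat \<Rightarrow> 'p tstate" where "nxt \<equiv> transducer_next b k d"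
abbreviation edge :: "'p nstate \<Rightarrow> nat \<Rightarrow> 'p nstate \<Rightarrow> bool" where "edge \<equiv> ndfa_edge n b k d"
abbreviation ps :: "'p tstate \<Rightarrow> nat \<Rightarrow> nat \<Rightarrow> 'p nstate" where "ps \<equiv> path_state b k d"

lemma K_nonempty: "K \<noteq> {}" and K_compact: "compact K"
  and K_eq: "K = (\<Union>i\<in>{1..n}. padic_similarity (b i) (k i) (d i) ` K)"
  using self_similar unfolding is_self_similar_set_def by blast+

lemma n_pos: "1 \<in> {1..n}"
proof (rule ccontr)
  assume "1 \<notin> {1..n}"
  then have "{1..n} = {}" by auto
  then show False using K_eq K_nonempty by auto
qed

text \<open>Compactness gives only some bound \<open>B\<close>. Each use of \<open>K_eq\<close>
  divides the part coming from \<open>K\<close> by at least \<open>p\<close>, and by the ultrametric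
  inequality adding \<open>d i\<close> cannot lift the norm above the maximum with 1; iterating
  brings the bound down to 1.\<close>

lemma K_padic_ints: "x \<in> K \<Longrightarrow> x \<in> padic_ints"
proof -
  have "bounded K" using K_compact by (rule compact_imp_bounded)
  then obtain B where B: "\<And>y. y \<in> K \<Longrightarrow> dist 0 y \<le> B"
    using bounded_any_center by blast
  have *: "padic_abs y \<le> max 1 (B / real CARD('p) ^ m)" if "y \<in> K" for y m
    using that
  proof (induction m arbitrary: y)
    case 0
    then show ?case using B[of y] by (simp add: dist_padic_def)
  next
    case (Suc m)
    then obtain i z where i: "i \<in> {1..n}" "z \<in> K" "y = padic_similarity (b i) (k i) (d i) z"
      using K_eq by blast
    have p1: "1 < real CARD('p)" using CARD_prime_gt_1[where 'p='p] by simp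
    have "padic_abs y \<le> max (padic_abs ((- 1) ^ b i * q ^ k i * z)) (padic_abs (d i))"
      unfolding i(3) padic_similarity_def by (rule padic_abs_add)
    also have "padic_abs ((- 1) ^ b i * q ^ k i * z) = padic_abs z / real CARD('p) ^ k i"
      by (simp add: mult.assoc padic_abs_mult[of "q ^ _"] padic_abs_p_power)
    also have "\<dots> \<le> padic_abs z / real CARD('p) ^ 1"
      using p1 k_pos[OF i(1)] by (intro divide_left_mono power_increasing) auto
    also have "\<dots> \<le> max 1 (B / real CARD('p) ^ m) / real CARD('p)"
      using Suc.IH[OF i(2)] p1 by (simp add: divide_right_mono)
    also have "\<dots> = max (1 / real CARD('p)) (B / real CARD('p) ^ Suc m)"
      using p1 by (simp add: max_divide_distrib_right mult.commute)
    finally have "padic_abs y \<le> max (max (1 / real CARD('p)) (B / real CARD('p) ^ Suc m)) (padic_abs (d i))"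
      by linarith
    moreover have "padic_abs (d i) \<le> 1" using d_int[OF i(1)] by (simp add: padic_ints_iff_abs)
    moreover have "1 / real CARD('p) \<le> 1" using p1 by simp
    ultimately show ?case by linarith
  qed
  show "x \<in> padic_ints" if "x \<in> K"
  proof -
    obtain m where "B < real CARD('p) ^ m"
      using real_arch_pow[of "real CARD('p)" B] CARD_prime_gt_1[where 'p='p] by auto
    then have "B / real CARD('p) ^ m \<le> 1" using CARD_prime_gt_1[where 'p='p] by simp
    then have "padic_abs x \<le> 1" using *[OF that, of m] by linarith
    then show ?thesis by (simp add: padic_ints_iff_abs)
  qed
qed

section \<open>Finiteness of the transducer\<close>

lemma TS_range: "s \<in> TS \<Longrightarrow> fst s \<in> padic_ints \<and> snd s \<in> {1, -1}"
  and val_padic_ints: "s \<in> TS \<Longrightarrow> i \<in> {1..n} \<Longrightarrow> val s i \<in> padic_ints"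
proof -
  have v: "val s i \<in> padic_ints" if "fst s \<in> padic_ints" "i \<in> {1..n}" for s i
    unfolding transducer_value_def
    using that d_int by (intro padic_ints_add padic_ints_mult padic_ints_of_int)
  show *: "fst s \<in> padic_ints \<and> snd s \<in> {1, -1}" if "s \<in> TS" for s
    using that
  proof induction
    case initial
    show ?case using padic_ints_of_nat[of 0] by simp
  next
    case (step s i)
    obtain z where z: "z \<in> padic_ints" "val s i = of_nat (padic_residue (k i) (val s i)) + q ^ k i * z"
      using padic_residue_decomp(2)[OF v] step by blast
    then have "val s i - of_nat (padic_residue (k i) (val s i)) = q ^ k i * z"
      by (metis add_diff_cancel_left')
    then have "fst (nxt s i) = z" by (simp add: transducer_next_def)
    moreover have "snd (nxt s i) \<in> {1, -1}"
      using step by (cases "even (b i)") (auto simp: transducer_next_def)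
    ultimately show ?case using z by simp
  qed
  show "val s i \<in> padic_ints" if "s \<in> TS" "i \<in> {1..n}" for s i
    using v * that by blast
qed

lemma nxt_TS: "s \<in> TS \<Longrightarrow> i \<in> {1..n} \<Longrightarrow> nxt s i \<in> TS"
  by (rule transducer_states.step)

text \<open>A common denominator \<open>Q\<close> of the translations clears the denominators of all states, and
  \<open>A + 2 Q\<close> bounds the resulting integers because each transition divides by at least \<open>p \<ge> 2\<close>.\<close>

lemma finite_TS: "finite TS"
proof -
  have "\<exists>u v. v > 0 \<and> d i = of_int u / of_int v" if "i \<in> {1..n}" for i
    using d_rat[OF that] by (metis Rats_cases')
  then obtain u v where uv: "\<And>i. i \<in> {1..n} \<Longrightarrow> v i > 0 \<and> d i = of_int (u i) / of_int (v i)" by metis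
  define Q where "Q = (\<Prod>i\<in>{1..n}. v i)"
  have Q0: "Q > 0" unfolding Q_def using uv by (intro prod_pos) auto
  have "\<exists>z. of_int Q * d i = of_int z" if i: "i \<in> {1..n}" for i
  proof -
    have "v i dvd Q" unfolding Q_def using i by (intro dvd_prodI) auto
    then obtain e where "Q = v i * e" by (rule dvdE)
    then have "of_int Q * d i = of_int (e * u i)" using uv[OF i] by simp
    then show ?thesis by blast
  qed
  then obtain z where z: "\<And>i. i \<in> {1..n} \<Longrightarrow> of_int Q * d i = of_int (z i)" by metis
  define A where "A = (\<Sum>i\<in>{1..n}. \<bar>z i\<bar>)"
  have A: "\<bar>z i\<bar> \<le> A" if "i \<in> {1..n}" for i
    unfolding A_def using that by (intro member_le_sum) auto
  define R where "R = A + 2 * Q"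
  have R0: "R \<ge> 0" unfolding R_def A_def using Q0 by (intro add_nonneg_nonneg sum_nonneg) auto
  have "\<exists>c. of_int Q * fst s = of_int c \<and> \<bar>c\<bar> \<le> R" if "s \<in> TS" for s
    using that
  proof induction
    case initial
    show ?case using R0 by (intro exI[of _ 0]) auto
  next
    case (step s i)
    then obtain c where c: "of_int Q * fst s = of_int c" "\<bar>c\<bar> \<le> R" by blast
    let ?D = "padic_residue (k i) (val s i)" and ?P = "int CARD('p) ^ k i"
    \<comment> \<open>\<open>y\<close> is the numerator, over the denominator \<open>Q\<close>, of
      \<open>p^(k i)\<close> times the next state; it remains to see that \<open>p^(k i)\<close>
      divides it in the integers.\<close>
    define y where "y = c + snd s * z i - Q * int ?D"
    have qk: "q ^ k i \<noteq> 0" by simp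
    have "of_int Q * (val s i - of_nat ?D) = of_int y"
      using c(1) z[OF step(2)] by (simp add: y_def transducer_value_def algebra_simps)
    moreover have "fst (nxt s i) = (val s i - of_nat ?D) / q ^ k i" by (simp add: transducer_next_def)
    ultimately have y: "of_int y = q ^ k i * (of_int Q * fst (nxt s i))"
      using qk by simp
    have "fst (nxt s i) \<in> padic_ints" using TS_range nxt_TS step by blast
    then have "of_int Q * fst (nxt s i) \<in> padic_ints" by (intro padic_ints_mult padic_ints_of_int)
    with y have "?P dvd y" by (rule of_int_eq_p_power_mult)
    then obtain y' where y': "y = ?P * y'" by (rule dvdE)
    then have "q ^ k i * (of_int Q * fst (nxt s i)) = q ^ k i * of_int y'" using y by simp
    then have "of_int Q * fst (nxt s i) = of_int y'" using qk by (simp only: mult_cancel_left) simp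
    moreover have "\<bar>y'\<bar> \<le> R"
    proof -
      have "?D < CARD('p) ^ k i" using padic_residue_decomp(1) val_padic_ints step by blast
      then have D: "int ?D \<le> ?P" by (metis of_nat_le_iff of_nat_power less_imp_le)
      have "snd s \<in> {1, -1}" using TS_range step by blast
      then have "\<bar>snd s * z i\<bar> \<le> A" using A[OF step(2)] by auto
      moreover have "\<bar>Q * int ?D\<bar> \<le> ?P * Q" using D Q0 by (simp add: abs_mult mult.commute mult_left_mono)
      ultimately have "\<bar>y\<bar> \<le> R + A + ?P * Q" using c(2) unfolding y_def by linarith
      also have "R + A = 2 * (A + Q)" by (simp add: R_def)
      also have "2 * (A + Q) \<le> ?P * (A + Q)"
      proof (rule mult_right_mono)
        have "int CARD('p) ^ 1 \<le> ?P"
          using k_pos[OF step(2)] CARD_prime_gt_1[where 'p='p] by (intro power_increasing) auto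
        then show "2 \<le> ?P" using CARD_prime_gt_1[where 'p='p] unfolding power_one_right by linarith
        show "0 \<le> A + Q" using Q0 by (auto simp: A_def intro!: add_nonneg_nonneg sum_nonneg)
      qed
      also have "?P * (A + Q) + ?P * Q = ?P * R" by (simp add: R_def algebra_simps)
      finally have "?P * \<bar>y'\<bar> \<le> ?P * R" by (simp add: y' abs_mult)
      then show ?thesis
        using CARD_prime_gt_1[where 'p='p] by (subst (asm) mult_le_cancel_left_pos) auto
    qed
    ultimately show ?case by blast
  qed
  then have "fst s \<in> (\<lambda>c. of_int c / of_int Q) ` {-R..R}" if "s \<in> TS" for s
    using that Q0 by (fastforce simp: field_simps image_iff abs_le_iff)
  then have "TS \<subseteq> ((\<lambda>c. of_int c / of_int Q) ` {-R..R}) \<times> {1, -1}"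
    using TS_range unfolding mem_Times_iff subset_iff by blast
  then show ?thesis by (rule finite_subset) auto
qed

text \<open>The points whose expansions are read off along the path \<open>ps s i j, ps s i (j + 1), \<dots>\<close>.\<close>

definition path_points :: "'p tstate \<Rightarrow> nat \<Rightarrow> nat \<Rightarrow> 'p padic set" where
  "path_points s i j = (\<lambda>y. (val s i - of_nat (padic_residue j (val s i))) / q ^ j
     + of_int (snd s * (- 1) ^ b i) * q ^ (k i - j) * y) ` K"

definition states :: "'p nstate set" where
  "states = {ps s i j | s i j. s \<in> TS \<and> i \<in> {1..n} \<and> j < k i}"

text \<open>The union matters at a state of the transducer, which starts a path for every
  \<open>i\<close>; an intermediate state lies on one path only.\<close>

definition points :: "'p nstate \<Rightarrow> 'p padic set" where
  "points t = \<Union> {path_points s i j | s i j. s \<in> TS \<and> i \<in> {1..n} \<and> j < k i \<and> ps s i j = t}"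

lemma mem_points_iff:
  "x \<in> points t
    \<longleftrightarrow> (\<exists>s i j. s \<in> TS \<and> i \<in> {1..n} \<and> j < k i \<and> ps s i j = t \<and> x \<in> path_points s i j)"
  unfolding points_def by blast

lemma ps_eq_iff:
  assumes "j < k i" "j' < k i'"
  shows "ps s i j = ps s' i' j' \<longleftrightarrow> s = s' \<and> j = j' \<and> (j = 0 \<or> i = i')"
  using assms by (auto simp: path_state_def)

lemma State_states: "s \<in> TS \<Longrightarrow> State s \<in> states"
  using k_pos[OF n_pos] n_pos unfolding states_def
  by (intro CollectI exI[of _ s] exI[of _ 1] exI[of _ 0]) (auto simp: path_state_def)

lemma ps_Suc_states:
  assumes "s \<in> TS" "i \<in> {1..n}" "j < k i"
  shows "ps s i (Suc j) \<in> states"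
proof (cases "Suc j = k i")
  case True
  then have "ps s i (Suc j) = State (nxt s i)" by (simp add: path_state_def)
  then show ?thesis using State_states nxt_TS assms by simp
next
  case False
  then have "Suc j < k i" using assms by simp
  then show ?thesis using assms unfolding states_def by blast
qed

lemma finite_states: "finite states"
proof -
  have "states \<subseteq> (\<lambda>(s, i, j). ps s i j) ` (TS \<times> (SIGMA i:{1..n}. {..<k i}))"
  proof
    fix t
    assume "t \<in> states"
    then obtain s i j where "s \<in> TS" "i \<in> {1..n}" "j < k i" "t = ps s i j"
      unfolding states_def by blast
    then show "t \<in> (\<lambda>(s, i, j). ps s i j) ` (TS \<times> (SIGMA i:{1..n}. {..<k i}))"
      by (intro rev_image_eqI[of "(s, i, j)"]) auto
  qed
  then show ?thesis using finite_TS by (auto intro: finite_subset)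
qed

lemma edge_states: "edge t a t' \<Longrightarrow> t \<in> states \<and> t' \<in> states"
proof (induction rule: ndfa_edge.induct)
  case (1 s i j)
  then have "ps s i j \<in> states" unfolding states_def by blast
  then show ?case using ps_Suc_states[OF 1] by blast
qed

text \<open>At \<open>j = 0\<close> no digit has been removed, so the sets for the different
  \<open>i\<close> are images of the pieces of \<open>K\<close> under one common map and reassemble
  to a copy of \<open>K\<close>.\<close>

lemma path_points_0:
  assumes "s \<in> TS"
  shows "(\<Union>i\<in>{1..n}. path_points s i 0) = (\<lambda>y. fst s + of_int (snd s) * y) ` K"
proof -
  have "padic_residue 0 (val s i) = 0" if "i \<in> {1..n}" for i
    using padic_residue_decomp(1)[OF val_padic_ints[OF assms that], of 0] by simp
  then have "path_points s i 0 = (\<lambda>y. fst s + of_int (snd s) * y) ` padic_similarity (b i) (k i) (d i) ` K"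
    if "i \<in> {1..n}" for i
    using that unfolding path_points_def image_image
    by (intro image_cong) (auto simp: transducer_value_def padic_similarity_def algebra_simps)
  then have "(\<Union>i\<in>{1..n}. path_points s i 0)
      = (\<lambda>y. fst s + of_int (snd s) * y) ` (\<Union>i\<in>{1..n}. padic_similarity (b i) (k i) (d i) ` K)"
    by auto
  then show ?thesis using K_eq by simp
qed

lemma points_State:
  assumes "s \<in> TS"
  shows "points (State s) = (\<lambda>y. fst s + of_int (snd s) * y) ` K"
proof -
  have st: "ps s' i j = State s \<longleftrightarrow> s' = s \<and> j = 0" if "j < k i" for s' i j
    using that by (auto simp: path_state_def)
  have "points (State s) = (\<Union>i\<in>{1..n}. path_points s i 0)"
  proof (intro equalityI subsetI)
    fix x
    assume "x \<in> points (State s)"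
    then show "x \<in> (\<Union>i\<in>{1..n}. path_points s i 0)"
      unfolding mem_points_iff using st by auto
  next
    fix x
    assume "x \<in> (\<Union>i\<in>{1..n}. path_points s i 0)"
    then obtain i where i: "i \<in> {1..n}" "x \<in> path_points s i 0" by blast
    then have "0 < k i" using k_pos by force
    then show "x \<in> points (State s)" unfolding mem_points_iff using i st assms by blast
  qed
  then show ?thesis using path_points_0[OF assms] by simp
qed

text \<open>An intermediate state determines its path. At the end of the path, the next state of the
  transducer encodes exactly the affine map that is left after all \<open>k i\<close> digits are
  removed.\<close>

lemma points_ps_Suc:
  assumes "s \<in> TS" "i \<in> {1..n}" "j < k i"
  shows "points (ps s i (Suc j)) = path_points s i (Suc j)"
proof (cases "Suc j = k i")
  case True
  then have "points (ps s i (Suc j)) = (\<lambda>y. fst (nxt s i) + of_int (snd (nxt s i)) * y) ` K"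
    using points_State nxt_TS assms by (simp add: path_state_def)
  also have "\<dots> = path_points s i (k i)"
    by (simp add: path_points_def transducer_next_def)
  finally show ?thesis using True by simp
next
  case False
  then have "Suc j < k i" using assms by simp
  then have "j' < k i' \<and> ps s' i' j' = ps s i (Suc j) \<longleftrightarrow> s' = s \<and> i' = i \<and> j' = Suc j" for s' i' j'
    using ps_eq_iff[of j' i' "Suc j" i s' s] by auto
  then have "x \<in> points (ps s i (Suc j)) \<longleftrightarrow> x \<in> path_points s i (Suc j)" for x
    unfolding mem_points_iff using assms(1,2) by metis
  then show ?thesis by blast
qed

text \<open>Passing from the residue modulo \<open>p^j\<close> to that modulo
  \<open>p^(j + 1)\<close> adds \<open>p^j\<close> times the digit output at position
  \<open>j\<close>; subtracting this digit leaves a multiple of \<open>p\<close>.\<close>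

lemma path_points_shift:
  assumes "s \<in> TS" "i \<in> {1..n}" "j < k i"
  shows "path_points s i j
    = (\<lambda>y. of_nat (transducer_output k d s i ! j) + q * y) ` path_points s i (Suc j)"
proof -
  let ?v = "val s i" and ?a = "transducer_output k d s i ! j"
  let ?R = "padic_residue (k i) ?v"
  have v: "?v \<in> padic_ints" using val_padic_ints assms by blast
  have "padic_residue (Suc j) ?v = ?R mod (CARD('p) ^ j * CARD('p))"
    using padic_residue_mod[OF v, of "Suc j" "k i"] assms(3) by (simp add: mult.commute)
  also have "\<dots> = CARD('p) ^ j * (?R div CARD('p) ^ j mod CARD('p)) + ?R mod CARD('p) ^ j"
    by (rule mod_mult2_eq)
  also have "\<dots> = CARD('p) ^ j * ?a + padic_residue j ?v"
    using padic_residue_mod[OF v, of j "k i"] assms(3) by (simp add: transducer_output_def)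
  finally have r: "(of_nat (padic_residue (Suc j) ?v) :: 'p padic) = q ^ j * of_nat ?a + of_nat (padic_residue j ?v)"
    by simp
  have "k i - j = Suc (k i - Suc j)" using assms(3) by simp
  then have qk: "q ^ (k i - j) = q * q ^ (k i - Suc j)" by simp
  have q0: "q \<noteq> 0" by simp
  have "(?v - of_nat (padic_residue j ?v)) / q ^ j + of_int (snd s * (- 1) ^ b i) * q ^ (k i - j) * y
      = of_nat ?a + q * ((?v - of_nat (padic_residue (Suc j) ?v)) / q ^ Suc j
          + of_int (snd s * (- 1) ^ b i) * q ^ (k i - Suc j) * y)" for y
    unfolding r qk using q0 by (simp add: field_simps)
  then show ?thesis unfolding path_points_def image_image by simp
qed

lemma output_less: "j < k i \<Longrightarrow> transducer_output k d s i ! j < CARD('p)"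
  using CARD_prime_gt_1[where 'p='p] by (simp add: transducer_output_def)

lemma edge_letter: "edge t a t' \<Longrightarrow> a < CARD('p)"
  by (induction rule: ndfa_edge.induct) (rule output_less)

text \<open>A graph-directed form of self-similarity in which every edge contributes one digit; it
  is the recursion behind \<open>acc_eq_digits\<close>.\<close>

lemma points_shift: "points t = {of_nat a + q * y | a t' y. edge t a t' \<and> y \<in> points t'}"
proof (intro equalityI subsetI)
  fix x
  assume "x \<in> points t"
  then obtain s i j where *: "s \<in> TS" "i \<in> {1..n}" "j < k i" "ps s i j = t" "x \<in> path_points s i j"
    unfolding points_def by blast
  then obtain y where "y \<in> points (ps s i (Suc j))" "x = of_nat (transducer_output k d s i ! j) + q * y"
    using path_points_shift[OF *(1-3)] points_ps_Suc[OF *(1-3)] by blast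
  moreover have "edge t (transducer_output k d s i ! j) (ps s i (Suc j))"
    using ndfa_edge.intros[OF *(1-3)] *(4) by simp
  ultimately show "x \<in> {of_nat a + q * y | a t' y. edge t a t' \<and> y \<in> points t'}" by blast
next
  fix x
  assume "x \<in> {of_nat a + q * y | a t' y. edge t a t' \<and> y \<in> points t'}"
  then obtain a t' y where *: "edge t a t'" "y \<in> points t'" "x = of_nat a + q * y" by blast
  from *(1) show "x \<in> points t"
  proof (cases rule: ndfa_edge.cases)
    case (1 s i j)
    then have "x \<in> path_points s i j"
      using * path_points_shift points_ps_Suc by blast
    then show ?thesis using 1 unfolding points_def by blast
  qed
qed

text \<open>The exponent \<open>l\<close> is the number of digits still to be read on the current
  path, and 0 at a state of the transducer. The sum of all \<open>k i\<close> serves as a uniform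
  bound.\<close>

lemma points_affine:
  assumes "t \<in> states"
  shows "\<exists>A e l. e \<in> {1, -1} \<and> l \<le> (\<Sum>i\<in>{1..n}. k i)
    \<and> points t = (\<lambda>y. A + of_int e * q ^ l * y) ` K"
proof -
  obtain s i j where *: "s \<in> TS" "i \<in> {1..n}" "j < k i" "t = ps s i j"
    using assms by (auto simp: states_def)
  have e: "snd s \<in> {1, -1}" using TS_range * by blast
  show ?thesis
  proof (cases j)
    case 0
    then have "points t = (\<lambda>y. fst s + of_int (snd s) * q ^ 0 * y) ` K"
      using points_State[OF *(1)] *(4) by (simp add: path_state_def)
    then show ?thesis using e by blast
  next
    case (Suc j')
    have "k i \<le> (\<Sum>i\<in>{1..n}. k i)" using *(2) by (intro member_le_sum) auto
    moreover have "snd s * (- 1) ^ b i \<in> {1, -1}" using e by (cases "even (b i)") auto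
    ultimately show ?thesis
      using points_ps_Suc[of s i j'] * Suc unfolding path_points_def
      by (intro exI[of _ "(val s i - of_nat (padic_residue j (val s i))) / q ^ j"]
          exI[of _ "snd s * (- 1) ^ b i"] exI[of _ "k i - j"]) auto
  qed
qed

lemma points_nonempty: "t \<in> states \<Longrightarrow> points t \<noteq> {}"
  using points_affine K_nonempty by blast

lemma points_padic_ints: "t \<in> states \<Longrightarrow> points t \<subseteq> padic_ints"
proof -
  have "path_points s i j \<subseteq> padic_ints" if *: "s \<in> TS" "i \<in> {1..n}" for s i j
  proof -
    obtain z where z: "z \<in> padic_ints" "val s i = of_nat (padic_residue j (val s i)) + q ^ j * z"
      using padic_residue_decomp(2)[OF val_padic_ints[OF *]] by blast
    have "(val s i - of_nat (padic_residue j (val s i))) / q ^ j = z"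
      using z(2) by (simp add: divide_eq_eq algebra_simps)
    moreover have "q ^ m \<in> padic_ints" for m by (metis of_nat_power padic_ints_of_nat)
    ultimately show ?thesis using z(1) K_padic_ints
      unfolding path_points_def by (auto intro!: padic_ints_add padic_ints_mult padic_ints_of_int simp del: of_int_mult of_int_power)
  qed
  then show "points t \<subseteq> padic_ints" unfolding points_def by blast
qed

section \<open>Readable words as digit prefixes\<close>

definition acc :: "nat \<Rightarrow> 'p nstate set \<Rightarrow> nat list set" where
  "acc m S = {w. length w = m \<and> foldl (dfa_step n b k d) S w \<noteq> {}}"

lemma acc_UN: "acc m S = (\<Union>t\<in>S. acc m {t})"
  using foldl_dfa_step_nonempty[of n b k d S] by (auto simp: acc_def)

text \<open>Both sides obey the same recursion over edges. Length 0 rests on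
  \<open>points_nonempty\<close>: no state is a dead end, so every readable word is the prefix of a
  point.\<close>

lemma acc_eq_digits:
  assumes "t \<in> states"
  shows "acc m {t} = digits m ` points t"
  using assms
proof (induction m arbitrary: t)
  case 0
  then show ?case using points_nonempty by (auto simp: acc_def)
next
  case (Suc m)
  have "acc (Suc m) {t} = {a # w | a w. w \<in> acc m {t'. edge t a t'}}"
    by (auto simp: acc_def dfa_step_def length_Suc_conv)
  also have "\<dots> = {a # w | a t' w. edge t a t' \<and> w \<in> acc m {t'}}"
    by (subst acc_UN) blast
  also have "\<dots> = {a # w | a t' w. edge t a t' \<and> w \<in> digits m ` points t'}"
    using Suc.IH edge_states by (intro Collect_cong ex_cong1 conj_cong refl) simp
  also have "\<dots> = {digits (Suc m) (of_nat a + q * y) | a t' y. edge t a t' \<and> y \<in> points t'}"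
  proof -
    have "digits (Suc m) (of_nat a + q * y) = a # digits m y" if "edge t a t'" "y \<in> points t'" for a t' y
      using that edge_letter edge_states points_padic_ints by (intro digits_shift) blast+
    then show ?thesis by (auto simp: image_iff) metis+
  qed
  also have "\<dots> = digits (Suc m) ` points t"
    by (subst points_shift[of t]) auto
  finally show ?case .
qed

lemma points_initial: "points (State (0, 1)) = K"
  using points_State[OF transducer_states.initial] by simp

lemma acc_initial: "acc m {State (0, 1)} = digits m ` K"
  using acc_eq_digits[OF State_states[OF transducer_states.initial]] by (simp add: points_initial)

text \<open>The affine image scales distances by \<open>p\<^sup>-\<^sup>l\<close>, so its points are told apart by exactly
  \<open>l\<close> more digits.\<close>

lemma card_acc_bounds:
  assumes "t \<in> states"
  shows "card (acc m {t}) \<le> card (digits m ` K)"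
    and "card (digits m ` K) \<le> CARD('p) ^ (\<Sum>i\<in>{1..n}. k i) * card (acc m {t})"
proof -
  let ?L = "\<Sum>i\<in>{1..n}. k i"
  obtain A e l where *: "e \<in> {1, -1}" "l \<le> ?L" "points t = (\<lambda>y. A + of_int e * q ^ l * y) ` K"
    using points_affine[OF assms] by blast
  define f where "f y = A + of_int e * q ^ l * y" for y
  have pts: "points t = f ` K" using *(3) by (simp add: f_def)
  have scale: "dist (f x) (f y) = dist x y / real CARD('p) ^ l" for x y
  proof -
    have "f x - f y = of_int e * (q ^ l * (x - y))" by (simp add: f_def algebra_simps)
    then show ?thesis
      using *(1) by (auto simp: dist_padic_def padic_abs_mult[of "q ^ l"] padic_abs_p_power)
  qed
  have "digits (m + l) (f x) = digits (m + l) (f y) \<longleftrightarrow> digits m x = digits m y"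
    if xy: "x \<in> K" "y \<in> K" for x y
  proof -
    have "f x \<in> padic_ints" "f y \<in> padic_ints" using xy points_padic_ints[OF assms] pts by auto
    then have "digits (m + l) (f x) = digits (m + l) (f y)
        \<longleftrightarrow> dist x y / real CARD('p) ^ l \<le> 1 / real CARD('p) ^ (m + l)"
      by (simp add: digits_eq_iff_dist scale)
    also have "\<dots> \<longleftrightarrow> dist x y \<le> 1 / real CARD('p) ^ m"
      using CARD_prime_gt_1[where 'p='p] by (simp add: power_add field_simps)
    finally show ?thesis using xy K_padic_ints by (simp add: digits_eq_iff_dist)
  qed
  then have eq: "card (digits m ` K) = card (digits (m + l) ` points t)"
    unfolding pts image_image by (intro card_image_eq_if_same_fibers) auto
  have "card (digits m ` points t) = card (take m ` digits (m + l) ` points t)"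
    by (simp add: image_image take_digits)
  also have "\<dots> \<le> card (digits (m + l) ` points t)"
    using finite_digits_image[OF points_padic_ints[OF assms]] by (rule card_image_le)
  finally show "card (acc m {t}) \<le> card (digits m ` K)" using eq acc_eq_digits[OF assms] by simp
  have "card (digits m ` K) \<le> CARD('p) ^ l * card (acc m {t})"
    unfolding eq acc_eq_digits[OF assms] by (rule card_digits_add[OF points_padic_ints[OF assms]])
  also have "\<dots> \<le> CARD('p) ^ ?L * card (acc m {t})"
    using *(2) by (intro mult_right_mono power_increasing) auto
  finally show "card (digits m ` K) \<le> CARD('p) ^ ?L * card (acc m {t})" .
qed

lemma dfa_states_subset: "S \<in> dfa_states n b k d \<Longrightarrow> S \<subseteq> states \<and> S \<noteq> {}"
proof (induction rule: dfa_states.induct)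
  case initial
  then show ?case using State_states[OF transducer_states.initial] by simp
next
  case (step S a)
  then show ?case using edge_states by (auto simp: dfa_step_def)
qed

text \<open>The lower constant comes from a single member of \<open>S\<close>, whose copy of
  \<open>K\<close> loses at most as many digits as the sum of the \<open>k i\<close>; the upper one
  from adding the counts of all members, each at most that of the initial state.\<close>

sublocale homogeneous_automaton "dfa_step n b k d" "{}" "{State (0, 1)}" "dfa_states n b k d"
  "1 / real CARD('p) ^ (\<Sum>i\<in>{1..n}. k i)" "real (card states)" acc "dfa_graph n b k d"
proof
  let ?L = "\<Sum>i\<in>{1..n}. k i"
  show "finite (dfa_states n b k d)"
    by (rule finite_subset[of _ "Pow states"]) (use dfa_states_subset finite_states in auto)
  show "{State (0, 1)} \<in> dfa_states n b k d" by (rule dfa_states.initial)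
  show "{} \<notin> dfa_states n b k d" using dfa_states_subset[of "{}"] by auto
  show "acc m {State (0, 1)} \<noteq> {}" for m using acc_initial K_nonempty by simp
  show "0 < 1 / real CARD('p) ^ ?L" using CARD_prime_gt_1[where 'p='p] by simp
  have fin1: "finite (acc m {t})" if "t \<in> states" for m t
    unfolding acc_eq_digits[OF that] by (rule finite_digits_image[OF points_padic_ints[OF that]])
  fix S m
  assume "S \<in> dfa_states n b k d"
  then have S: "S \<subseteq> states" "S \<noteq> {}" "finite S" using dfa_states_subset finite_states finite_subset by blast+
  show fin: "finite (acc m S)"
    using fin1 S by (subst acc_UN) auto
  obtain t where t: "t \<in> S" using S(2) by blast
  then have "acc m {t} \<subseteq> acc m S" by (subst acc_UN[of m S]) blast
  then have "card (acc m {t}) \<le> card (acc m S)" using fin by (intro card_mono)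
  then have "CARD('p) ^ ?L * card (acc m {t}) \<le> CARD('p) ^ ?L * card (acc m S)" by simp
  then have "card (digits m ` K) \<le> CARD('p) ^ ?L * card (acc m S)"
    using card_acc_bounds(2)[of t m] t S(1) by (meson order_trans subsetD)
  then have "real (card (digits m ` K)) \<le> real CARD('p) ^ ?L * real (card (acc m S))"
    by (metis of_nat_le_iff of_nat_mult of_nat_power)
  then show "1 / real CARD('p) ^ ?L * real (card (acc m {State (0, 1)})) \<le> real (card (acc m S))"
    using CARD_prime_gt_1[where 'p='p] by (simp add: acc_initial field_simps)
  have "card (acc m S) \<le> (\<Sum>t\<in>S. card (acc m {t}))"
    by (subst acc_UN) (rule card_UN_le[OF S(3)])
  also have "\<dots> \<le> (\<Sum>t\<in>S. card (digits m ` K))"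
    using S(1) card_acc_bounds(1) by (intro sum_mono) blast
  also have "\<dots> \<le> card states * card (digits m ` K)"
    using S(1) finite_states by (simp add: card_mono)
  finally show "real (card (acc m S)) \<le> real (card states) * real (card (acc m {State (0, 1)}))"
    by (simp add: acc_initial flip: of_nat_mult)
qed (simp_all add: acc_def dfa_graph_def dfa_states.step, simp add: dfa_step_def)

end


section \<open>Hausdorff measure of sets of \<open>p\<close>-adic integers\<close>

lemma diameter_le_metric:
  fixes U :: "'a::metric_space set"
  assumes "0 \<le> r" "\<And>x y. x \<in> U \<Longrightarrow> y \<in> U \<Longrightarrow> dist x y \<le> r"
  shows "bounded U" "diameter U \<le> r"
proof -
  show "bounded U" using assms(2) unfolding bounded_def by (cases "U = {}") blast+
  show "diameter U \<le> r"
    using assms by (auto simp: diameter_def intro!: cSUP_least)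
qed

lemma diam_power_le:
  assumes "bounded U" "diameter U \<le> r" "0 < r" "0 \<le> s"
  shows "diam_power s U \<le> ennreal (r powr s)"
  using assms diameter_ge_0[OF assms(1)] by (auto simp: diam_power_def intro!: ennreal_leI powr_mono2)

lemma inverse_p_power_powr:
  "(1 / real CARD('p::prime_card) ^ m) powr s = exp (- (s * ln (real CARD('p)) * real m))"
  using CARD_prime_gt_1[where 'p='p] by (simp add: powr_def ln_div ln_realpow)

text \<open>Digit cylinders form the cover. The sequence is padded with empty sets, which
  \<open>diam_power\<close> counts as 0 even for \<open>s = 0\<close>.\<close>

lemma hausdorff_premeasure_le_digits:
  fixes A :: "'p::prime_card padic set"
  assumes A: "A \<subseteq> padic_ints" and s: "0 \<le> s" and \<delta>: "1 / real CARD('p) ^ m \<le> \<delta>"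
  shows "hausdorff_premeasure s \<delta> A
    \<le> ennreal (real (card (digits m ` A)) * exp (- (s * ln (real CARD('p)) * real m)))"
proof -
  let ?W = "digits m ` A" and ?r = "1 / real CARD('p) ^ m"
  have fin: "finite ?W" using A by (rule finite_digits_image)
  obtain g where g: "bij_betw g {0..<card ?W} ?W" using ex_bij_betw_nat_finite[OF fin] by blast
  define U where "U i = (if i < card ?W then {x \<in> A. digits m x = g i} else {})" for i
  have r0: "0 < ?r" using CARD_prime_gt_1[where 'p='p] by simp
  have "dist x y \<le> ?r" if "x \<in> U i" "y \<in> U i" for x y i
    using that A digits_eq_iff_dist[of x y m] by (auto simp: U_def split: if_splits)
  then have U: "bounded (U i)" "diameter (U i) \<le> ?r" for i
    using r0 diameter_le_metric[of ?r "U i"] by auto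
  have "A \<subseteq> (\<Union>i. U i)"
  proof
    fix x
    assume x: "x \<in> A"
    then have "digits m x \<in> g ` {0..<card ?W}" using bij_betw_imp_surj_on[OF g] by simp
    then obtain i where "i < card ?W" "digits m x = g i" by auto
    then have "x \<in> U i" using x by (simp add: U_def)
    then show "x \<in> (\<Union>i. U i)" by blast
  qed
  then have "hausdorff_premeasure s \<delta> A \<le> (\<Sum>i. diam_power s (U i))"
    unfolding hausdorff_premeasure_def using U \<delta> by (intro INF_lower) (auto intro: order_trans)
  also have "\<dots> = (\<Sum>i<card ?W. diam_power s (U i))"
    by (intro suminf_finite) (auto simp: U_def diam_power_def)
  also have "\<dots> \<le> (\<Sum>i<card ?W. ennreal (?r powr s))"
    using U r0 s by (intro sum_mono diam_power_le)
  also have "\<dots> = ennreal (real (card ?W) * ?r powr s)"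
    by (simp add: ennreal_mult' ennreal_of_nat_eq_real_of_nat)
  finally show ?thesis by (simp only: inverse_p_power_powr)
qed

lemma exists_inverse_p_power_le:
  assumes "0 < \<delta>"
  shows "\<exists>m. 1 / real CARD('p::prime_card) ^ m \<le> \<delta>"
proof -
  obtain m where "(1 / real CARD('p)) ^ m < \<delta>"
    using real_arch_pow_inv[OF assms, of "1 / real CARD('p)"] CARD_prime_gt_1[where 'p='p] by auto
  then show ?thesis by (intro exI[of _ m]) (simp add: power_one_over)
qed

lemma hausdorff_measure_le_digits:
  fixes A :: "'p::prime_card padic set"
  assumes "A \<subseteq> padic_ints" "0 \<le> s"
    and C: "\<And>m. real (card (digits m ` A)) * exp (- (s * ln (real CARD('p)) * real m)) \<le> C"
  shows "hausdorff_measure s A \<le> ennreal C"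
  unfolding hausdorff_measure_def
proof (rule SUP_least)
  fix \<delta> :: real
  assume "\<delta> \<in> {0<..}"
  then obtain m where "1 / real CARD('p) ^ m \<le> \<delta>" using exists_inverse_p_power_le by auto
  then show "hausdorff_premeasure s \<delta> A \<le> ennreal C"
    using hausdorff_premeasure_le_digits[OF assms(1,2)] ennreal_leI[OF C] by (meson order_trans)
qed

text \<open>Only multiples of \<open>r\<close> occur because the decay of bad words is established
  at these lengths; they still give arbitrarily fine covers since \<open>r \<ge> 1\<close>.\<close>

lemma hausdorff_measure_eq_0_digits:
  fixes A :: "'p::prime_card padic set"
  assumes A: "A \<subseteq> padic_ints" and s: "0 \<le> s" and r: "1 \<le> r" and \<rho>: "0 \<le> \<rho>" "\<rho> < 1"
    and C: "\<And>j. real (card (digits (j * r) ` A)) * exp (- (s * ln (real CARD('p)) * real (j * r))) \<le> C * \<rho> ^ j"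
  shows "hausdorff_measure s A = 0"
proof -
  have "hausdorff_premeasure s \<delta> A \<le> 0" if \<delta>: "0 < \<delta>" for \<delta>
  proof -
    obtain m where m: "1 / real CARD('p) ^ m \<le> \<delta>" using exists_inverse_p_power_le[OF \<delta>] by blast
    have "hausdorff_premeasure s \<delta> A \<le> ennreal (C * \<rho> ^ j)" if "m \<le> j" for j
    proof -
      have "m \<le> j * r" using that r by (metis mult_le_mono nat_mult_1_right)
      then have "1 / real CARD('p) ^ (j * r) \<le> 1 / real CARD('p) ^ m"
        using CARD_prime_gt_1[where 'p='p] by (intro divide_left_mono power_increasing) auto
      with m have "1 / real CARD('p) ^ (j * r) \<le> \<delta>" by linarith
      then show ?thesis
        using hausdorff_premeasure_le_digits[OF A s] ennreal_leI[OF C] by (meson order_trans)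
    qed
    moreover have "(\<lambda>j. C * \<rho> ^ j) \<longlonglongrightarrow> C * 0"
      using \<rho> by (intro tendsto_mult LIMSEQ_power_zero tendsto_const) auto
    then have "(\<lambda>j. ennreal (C * \<rho> ^ j)) \<longlonglongrightarrow> 0"
      using tendsto_ennrealI by fastforce
    ultimately show ?thesis
      by (intro tendsto_lowerbound[of "\<lambda>j. ennreal (C * \<rho> ^ j)" 0 sequentially])
        (auto simp: eventually_sequentially)
  qed
  then show ?thesis unfolding hausdorff_measure_def by (auto simp: SUP_eq_iff intro!: antisym SUP_least)
qed

section \<open>Measure and dimension of \<open>K\<close> and of its non-essential points\<close>

context padic_ifs
begin

text \<open>Instead of a mass distribution, a cover of \<open>K\<close> is compared with a finite cover by cylinders:
  the sets of a cover are enclosed in balls, of which finitely many suffice by compactness.\<close>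

lemma hausdorff_premeasure_lower_bound:
  assumes h0: "0 \<le> h"
    and h: "\<And>m. 1 / real CARD('p) ^ (\<Sum>i\<in>{1..n}. k i) * N m \<le> exp (h * real m)
      \<and> exp (h * real m) \<le> real (card states) * N m"
    and s: "0 \<le> s" "s * ln (real CARD('p)) \<le> h"
  shows "\<exists>\<kappa>>0. ennreal \<kappa> \<le> hausdorff_premeasure s (1 / real CARD('p)) K"
proof -
  define \<kappa>0 where "\<kappa>0 = 1 / real CARD('p) ^ (\<Sum>i\<in>{1..n}. k i) / (real (card states))\<^sup>2"
  have p1: "1 < real CARD('p)" using CARD_prime_gt_1[where 'p='p] by simp
  have \<kappa>0: "0 < \<kappa>0" using lo_pos hi_ge_1 unfolding \<kappa>0_def by (intro divide_pos_pos) auto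
  \<comment> \<open>Each set is traded for a ball, open so that compactness of \<open>K\<close>
    applies. The factor \<open>exp h\<close> pays for rounding the diameter up to a power of
    \<open>p\<close>, and \<open>e\<close> for sets of diameter 0.\<close>
  have enclose: "\<exists>x m. x \<in> K \<and> V \<subseteq> ball x (1 / real CARD('p) ^ m)
      \<and> ennreal (exp (- h * real m)) \<le> ennreal (exp h) * diam_power s V + ennreal e"
    if V: "V \<inter> K \<noteq> {}" "bounded V" "diameter V \<le> 1 / real CARD('p)" and e: "0 < e" for V and e :: real
  proof -
    obtain x where x: "x \<in> V" "x \<in> K" using V(1) by blast
    have dist: "dist x y \<le> diameter V" if "y \<in> V" for y
      using diameter_bounded_bound[OF V(2) x(1) that] by simp
    show ?thesis
    proof (cases "diameter V = 0")
      case False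
      then have pos: "0 < diameter V" using diameter_ge_0[OF V(2)] by simp
      obtain m0 where "1 / real CARD('p) ^ m0 \<le> diameter V"
        using exists_inverse_p_power_le[OF pos] by blast
      moreover have "1 / real CARD('p) ^ Suc m0 \<le> 1 / real CARD('p) ^ m0"
        using p1 by (intro divide_left_mono power_increasing) auto
      ultimately have ex: "1 / real CARD('p) ^ Suc m0 \<le> diameter V" by linarith
      define m where "m = (LEAST m. 1 / real CARD('p) ^ Suc m \<le> diameter V)"
      have m1: "1 / real CARD('p) ^ Suc m \<le> diameter V" unfolding m_def using ex by (rule LeastI)
      \<comment> \<open>The bound \<open>1 / p\<close> on the diameters enters here: it makes the
        inequality strict also for \<open>m = 0\<close>.\<close>
      have m2: "diameter V < 1 / real CARD('p) ^ m"
      proof (cases m)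
        case 0
        have "1 / real CARD('p) < 1" using p1 by simp
        then have "diameter V < 1" using V(3) by linarith
        then show ?thesis using 0 by simp
      next
        case (Suc l)
        then have "\<not> 1 / real CARD('p) ^ Suc l \<le> diameter V"
          unfolding m_def using not_less_Least[of l] by (metis lessI m_def)
        then show ?thesis using Suc by simp
      qed
      have "s * ln (real CARD('p)) * real (Suc m) \<le> h * real (Suc m)"
        using s(2) by (intro mult_right_mono) auto
      then have "exp (- h * real (Suc m)) \<le> (1 / real CARD('p) ^ Suc m) powr s"
        unfolding inverse_p_power_powr by simp
      also have "\<dots> \<le> diameter V powr s" using m1 p1 s(1) by (intro powr_mono2) auto
      finally have "ennreal (exp (- h * real (Suc m))) \<le> diam_power s V"
        using x(1) pos s(1) by (auto simp: diam_power_def ennreal_leI)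
      then have "ennreal (exp h) * ennreal (exp (- h * real (Suc m))) \<le> ennreal (exp h) * diam_power s V"
        by (rule mult_left_mono) simp
      moreover have "ennreal (exp h) * ennreal (exp (- h * real (Suc m))) = ennreal (exp (- h * real m))"
        by (simp add: algebra_simps flip: ennreal_mult exp_add)
      ultimately have "ennreal (exp (- h * real m)) \<le> ennreal (exp h) * diam_power s V + ennreal e"
        by (metis add_increasing2 zero_le)
      moreover have "V \<subseteq> ball x (1 / real CARD('p) ^ m)" using dist m2 by (fastforce simp: mem_ball)
      ultimately show ?thesis using x by blast
    next
      case True
      have sub: "V \<subseteq> ball x (1 / real CARD('p) ^ m)" for m
        using dist True p1 by (auto simp: mem_ball)
      \<comment> \<open>A single point fits into cylinders of every length. For positive
        \<open>h\<close> a long one costs less than \<open>e\<close>; for \<open>h = 0\<close> also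
        \<open>s = 0\<close>, and the convention that a nonempty set then counts 1 pays for
        it.\<close>
      have "\<exists>m. ennreal (exp (- h * real m)) \<le> ennreal (exp h) * diam_power s V + ennreal e"
      proof (cases "h = 0")
        case True
        then have "s = 0" using s p1 by (metis ln_gt_zero mult_le_0_iff not_le order_antisym)
        then have "diam_power s V = 1" using x(1) by (auto simp: diam_power_def)
        then show ?thesis using True by (intro exI[of _ 0]) (auto simp: add_increasing2)
      next
        case False
        then obtain m where "exp (- h) ^ m < e"
          using real_arch_pow_inv[OF e, of "exp (- h)"] h0 by auto
        then have "exp (- h * real m) \<le> e" by (simp add: exp_of_nat_mult[symmetric] mult.commute)
        then show ?thesis by (intro exI[of _ m] add_increasing ennreal_leI) auto
      qed
      with sub x show ?thesis by blast
    qed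
  qed
  have "ennreal (exp (- h) * \<kappa>0) \<le> hausdorff_premeasure s (1 / real CARD('p)) K"
    unfolding hausdorff_premeasure_def
  proof (rule INF_greatest, clarify)
    fix U :: "nat \<Rightarrow> 'p padic set"
    assume cov: "K \<subseteq> (\<Union>i. U i)" and U: "\<forall>i. bounded (U i) \<and> diameter (U i) \<le> 1 / real CARD('p)"
    define S where "S = (\<Sum>i. diam_power s (U i))"
    have "ennreal \<kappa>0 \<le> ennreal (exp h) * S"
    proof (rule ennreal_le_epsilon)
      fix e :: real
      assume e: "0 < e"
      define I where "I = {i. U i \<inter> K \<noteq> {}}"
      have "\<exists>x m. x \<in> K \<and> U i \<subseteq> ball x (1 / real CARD('p) ^ m)
          \<and> ennreal (exp (- h * real m)) \<le> ennreal (exp h) * diam_power s (U i) + ennreal (e * (1 / 2) ^ Suc i)"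
        if "i \<in> I" for i
        using that U e by (intro enclose) (auto simp: I_def)
      then obtain x m where xm: "\<And>i. i \<in> I \<Longrightarrow> x i \<in> K \<and> U i \<subseteq> ball (x i) (1 / real CARD('p) ^ m i)
          \<and> ennreal (exp (- h * real (m i))) \<le> ennreal (exp h) * diam_power s (U i) + ennreal (e * (1 / 2) ^ Suc i)"
        by metis
      have "K \<subseteq> (\<Union>i\<in>I. ball (x i) (1 / real CARD('p) ^ m i))"
        using cov xm unfolding I_def by blast
      then obtain F where F: "F \<subseteq> I" "finite F" "K \<subseteq> (\<Union>i\<in>F. ball (x i) (1 / real CARD('p) ^ m i))"
        by (rule compactE_image[OF K_compact, rotated]) auto
      let ?w = "\<lambda>i. digits (m i) (x i)" and ?M = "\<Sum>i\<in>F. m i"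
      have mM: "m i \<le> ?M" if "i \<in> F" for i using that F(2) by (intro member_le_sum) auto
      have "\<kappa>0 \<le> (\<Sum>i\<in>F. exp (- h * real (length (?w i))))"
        unfolding \<kappa>0_def
      proof (rule cylinder_cover[OF h F(2), of ?w ?M])
        show "length (?w i) \<le> ?M" if "i \<in> F" for i using mM[OF that] by simp
        fix v
        assume "v \<in> acc ?M {State (0, 1)}"
        then obtain y where y: "y \<in> K" "v = digits ?M y" by (auto simp: acc_initial)
        then obtain i where i: "i \<in> F" "dist (x i) y < 1 / real CARD('p) ^ m i"
          using F(3) by (auto simp: mem_ball)
        then have "digits (m i) (x i) = digits (m i) y"
          using xm F(1) y K_padic_ints by (subst digits_eq_iff_dist) auto
        then show "\<exists>i\<in>F. take (length (?w i)) v = ?w i"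
          using i y mM[OF i(1)] by (intro bexI[of _ i]) (auto simp: take_digits)
      qed
      then have "ennreal \<kappa>0 \<le> ennreal (\<Sum>i\<in>F. exp (- h * real (m i)))" by (intro ennreal_leI) simp
      also have "\<dots> = (\<Sum>i\<in>F. ennreal (exp (- h * real (m i))))" by (subst sum_ennreal) auto
      also have "\<dots> \<le> (\<Sum>i\<in>F. ennreal (exp h) * diam_power s (U i) + ennreal (e * (1 / 2) ^ Suc i))"
        using xm F(1) by (intro sum_mono) blast
      also have "\<dots> = ennreal (exp h) * (\<Sum>i\<in>F. diam_power s (U i)) + ennreal (\<Sum>i\<in>F. e * (1 / 2) ^ Suc i)"
        using e by (simp add: sum.distrib sum_distrib_left sum_ennreal)
      also have "\<dots> \<le> ennreal (exp h) * S + ennreal e"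
      proof (rule add_mono)
        show "ennreal (exp h) * (\<Sum>i\<in>F. diam_power s (U i)) \<le> ennreal (exp h) * S"
          unfolding S_def using F(2) by (intro mult_left_mono sum_le_suminf) auto
        have "(\<lambda>i. e * (1 / 2) ^ Suc i) sums (e * 1)" by (intro sums_mult power_half_series)
        then have "(\<Sum>i\<in>F. e * (1 / 2) ^ Suc i) \<le> e"
          using F(2) e sum_le_suminf[of "\<lambda>i. e * (1 / 2) ^ Suc i" F] by (auto simp: sums_iff)
        then show "ennreal (\<Sum>i\<in>F. e * (1 / 2) ^ Suc i) \<le> ennreal e" by (rule ennreal_leI)
      qed
      finally show "ennreal \<kappa>0 \<le> ennreal (exp h) * S + ennreal e" .
    qed
    then have "ennreal (exp (- h)) * ennreal \<kappa>0 \<le> ennreal (exp (- h)) * (ennreal (exp h) * S)"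
      by (rule mult_left_mono) simp
    also have "\<dots> = S" by (simp add: mult.assoc[symmetric] flip: ennreal_mult exp_add)
    finally show "ennreal (exp (- h) * \<kappa>0) \<le> (\<Sum>i. diam_power s (U i))"
      using \<kappa>0 by (simp add: S_def ennreal_mult)
  qed
  then show ?thesis using \<kappa>0 by (intro exI[of _ "exp (- h) * \<kappa>0"]) auto
qed

text \<open>A run that meets an essential class stays in it, which makes the point essential. Hence
  every prefix of a non-essential point is a bad word, not only the late ones.\<close>

lemma nonessential_digits: "digits m ` nonessential_points n b k d K \<subseteq> bad_words m"
proof
  fix w
  assume "w \<in> digits m ` nonessential_points n b k d K"
  then obtain x where x: "x \<in> K" "\<not> is_essential n b k d x" and w: "w = digits m x"
    by (auto simp: nonessential_points_def)
  let ?V = "dfa_states n b k d" and ?E = "dfa_graph n b k d"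
  have run: "dfa_run n b k d x j \<in> ?V" for j
  proof -
    have "digits j x \<in> acc j {State (0, 1)}" using x acc_initial by blast
    then show ?thesis using acc_run_V[OF s0_V] by (simp add: dfa_run_eq_foldl)
  qed
  have "dfa_run n b k d x m \<notin> C" if C: "essential_class ?V ?E C" for C
  proof
    assume m: "dfa_run n b k d x m \<in> C"
    have "dfa_run n b k d x (m + l) \<in> C" for l
    proof (induction l)
      case (Suc l)
      have "(dfa_run n b k d x (m + l), dfa_run n b k d x (m + Suc l)) \<in> ?E"
        using run[of "m + l"] run[of "m + Suc l"] dead_V by (auto simp: dfa_graph_def)
      with Suc C show ?case unfolding essential_class_def by blast
    qed (use m in simp)
    then have "\<forall>\<^sub>F j in sequentially. dfa_run n b k d x j \<in> C"
      unfolding eventually_sequentially by (metis le_Suc_ex)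
    then show False using x(2) C unfolding is_essential_def by blast
  qed
  then have "dfa_run n b k d x m \<in> Bad" using run[of m] by (simp add: Bad_def)
  then show "w \<in> bad_words m"
    using x acc_initial[of m] by (auto simp: w bad_words_def dfa_run_eq_foldl)
qed

lemma hausdorff_measure_nonessential:
  defines "K' \<equiv> nonessential_points n b k d K"
  shows "\<exists>D\<ge>0. hausdorff_dim K = ereal D \<and> 0 < hausdorff_measure D K \<and> hausdorff_measure D K < \<infinity>
    \<and> hausdorff_measure D K' = 0 \<and> hausdorff_dim K' < ereal D"
proof -
  let ?L = "ln (real CARD('p))" and ?lo = "1 / real CARD('p) ^ (\<Sum>i\<in>{1..n}. k i)"
  have L: "0 < ?L" using CARD_prime_gt_1[where 'p='p] by simp
  obtain h where h0: "0 \<le> h"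
    and h: "\<And>m. ?lo * N m \<le> exp (h * real m) \<and> exp (h * real m) \<le> real (card states) * N m"
    using growth by blast
  \<comment> \<open>At \<open>s = D\<close> the weight \<open>p^(- s * m)\<close> equals
    \<open>exp (- h * m)\<close>, which cancels the growth of \<open>N m\<close>.\<close>
  define D where "D = h / ?L"
  have D0: "0 \<le> D" and DL: "D * ?L = h" using h0 L by (auto simp: D_def)
  have N: "N m = real (card (digits m ` K))" for m by (simp add: N_def acc_initial)
  have upper: "N m \<le> 1 / ?lo * exp (h * real m)" for m
    using h[of m] lo_pos by (simp add: field_simps)
  have Ki: "K \<subseteq> padic_ints" using K_padic_ints by blast
  have K'i: "K' \<subseteq> padic_ints" using Ki by (auto simp: K'_def nonessential_points_def)
  have "N m * exp (- (D * ?L * real m)) \<le> 1 / ?lo" for m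
  proof -
    have "N m * exp (- (D * ?L * real m)) \<le> 1 / ?lo * exp (h * real m) * exp (- (D * ?L * real m))"
      using upper by (intro mult_right_mono) auto
    then show ?thesis by (simp add: DL mult.assoc flip: exp_add)
  qed
  then have "hausdorff_measure D K \<le> ennreal (1 / ?lo)"
    using hausdorff_measure_le_digits[OF Ki D0] by (simp add: N)
  then have fin: "hausdorff_measure D K < \<infinity>"
    by (metis ennreal_less_top infinity_ennreal_def order_le_less_trans)
  \<comment> \<open>Exponents below \<open>D\<close> are included because the lower bound on the
    dimension needs them.\<close>
  have pos: "0 < hausdorff_measure s K" if s: "0 \<le> s" "s \<le> D" for s
  proof -
    have "s * ?L \<le> D * ?L" using s L by (intro mult_right_mono) auto
    then obtain \<kappa> where \<kappa>: "\<kappa> > 0" "ennreal \<kappa> \<le> hausdorff_premeasure s (1 / real CARD('p)) K"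
      using hausdorff_premeasure_lower_bound[OF h0 h s(1)] DL by auto
    have "hausdorff_premeasure s (1 / real CARD('p)) K \<le> hausdorff_measure s K"
      unfolding hausdorff_measure_def using CARD_prime_gt_1[where 'p='p] by (intro SUP_upper) auto
    with \<kappa> have "ennreal \<kappa> \<le> hausdorff_measure s K" by simp
    then show ?thesis using \<kappa>(1) by (metis ennreal_less_zero_iff order_less_le_trans)
  qed
  have zero: "hausdorff_measure s K = 0" if "D < s" for s
  proof (rule hausdorff_measure_eq_0_digits[OF Ki])
    show "0 \<le> s" using that D0 by simp
    have "h < s * ?L" using that L by (simp flip: DL)
    then show "exp (h - s * ?L) < 1" by simp
    fix j :: nat
    have "N j * exp (- (s * ?L * real j)) \<le> 1 / ?lo * exp (h * real j) * exp (- (s * ?L * real j))"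
      using upper by (intro mult_right_mono) auto
    also have "\<dots> = 1 / ?lo * exp (h - s * ?L) ^ j"
      by (simp add: algebra_simps flip: exp_add exp_of_nat_mult)
    finally show "real (card (digits (j * 1) ` K)) * exp (- (s * ?L * real (j * 1))) \<le> 1 / ?lo * exp (h - s * ?L) ^ j"
      by (simp add: N)
  qed auto
  have dim: "hausdorff_dim K = ereal D"
  proof -
    have "(INF s\<in>{s. 0 \<le> s \<and> hausdorff_measure s K = 0}. ereal s) = ereal D"
    proof (rule antisym)
      show "ereal D \<le> (INF s\<in>{s. 0 \<le> s \<and> hausdorff_measure s K = 0}. ereal s)"
      proof (rule INF_greatest)
        fix s
        assume "s \<in> {s. 0 \<le> s \<and> hausdorff_measure s K = 0}"
        then have "\<not> s \<le> D" using pos[of s] by auto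
        then show "ereal D \<le> ereal s" by simp
      qed
      show "(INF s\<in>{s. 0 \<le> s \<and> hausdorff_measure s K = 0}. ereal s) \<le> ereal D"
      proof (rule ereal_le_epsilon2)
        fix e :: real
        assume "0 < e"
        then show "(INF s\<in>{s. 0 \<le> s \<and> hausdorff_measure s K = 0}. ereal s) \<le> ereal D + ereal e"
          using zero[of "D + e"] D0 by (intro INF_lower2[of "D + e"]) auto
      qed
    qed
    then show ?thesis using K_nonempty by (simp add: hausdorff_dim_def)
  qed
  obtain r \<theta> where r: "1 \<le> r" and \<theta>: "0 < \<theta>" "\<theta> < 1"
    and bad: "\<And>j. real (card (bad_words (j * r))) \<le> \<theta> ^ j * N (j * r)"
    using bad_words_decay by blast
  have K'_card: "real (card (digits (j * r) ` K')) \<le> 1 / ?lo * (\<theta> ^ j * exp (h * real (j * r)))" for j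
  proof -
    have "finite (bad_words (j * r))" using finite_acc[OF s0_V] by (auto simp: bad_words_def)
    then have "card (digits (j * r) ` K') \<le> card (bad_words (j * r))"
      unfolding K'_def using nonessential_digits by (intro card_mono)
    then have "real (card (digits (j * r) ` K')) \<le> \<theta> ^ j * N (j * r)" using bad[of j] by linarith
    also have "\<dots> \<le> \<theta> ^ j * (1 / ?lo * exp (h * real (j * r)))"
      using upper[of "j * r"] \<theta> by (intro mult_left_mono) auto
    finally show ?thesis by (simp add: mult_ac)
  qed
  \<comment> \<open>Half of the gain \<open>ln \<theta>\<close> is spent on lowering the exponent
    below \<open>D\<close>; the other half leaves the square root of \<open>\<theta>\<close> as a
    convergent ratio.\<close>
  have zero': "hausdorff_measure s K' = 0" if s: "0 \<le> s" "h * real r + ln \<theta> / 2 \<le> s * ?L * real r" for s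
  proof (rule hausdorff_measure_eq_0_digits[OF K'i s(1) r])
    show "exp (ln \<theta> / 2) < 1" using \<theta> by simp
    fix j :: nat
    have \<theta>j: "\<theta> ^ j = exp (real j * ln \<theta>)" using \<theta> by (simp add: exp_of_nat_mult)
    have "real j * (h * real r + ln \<theta> / 2) \<le> real j * (s * ?L * real r)"
      using s(2) by (intro mult_left_mono) auto
    then have le: "real j * ln \<theta> + h * real (j * r) + - (s * ?L * real (j * r)) \<le> real j * (ln \<theta> / 2)"
      by (simp add: algebra_simps)
    have "real (card (digits (j * r) ` K')) * exp (- (s * ?L * real (j * r)))
        \<le> 1 / ?lo * (\<theta> ^ j * exp (h * real (j * r))) * exp (- (s * ?L * real (j * r)))"
      using K'_card by (intro mult_right_mono) auto
    also have "\<dots> = 1 / ?lo * exp (real j * ln \<theta> + h * real (j * r) + - (s * ?L * real (j * r)))"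
      unfolding \<theta>j by (simp only: exp_add mult.assoc)
    also have "\<dots> \<le> 1 / ?lo * exp (real j * (ln \<theta> / 2))"
      using le lo_pos by (intro mult_left_mono) auto
    finally show "real (card (digits (j * r) ` K')) * exp (- (s * ?L * real (j * r))) \<le> 1 / ?lo * exp (ln \<theta> / 2) ^ j"
      by (simp only: exp_of_nat_mult)
  qed simp
  have "hausdorff_measure D K' = 0" using zero'[OF D0] \<theta> by (simp add: DL)
  moreover have "hausdorff_dim K' < ereal D"
  proof (cases "K' = {}")
    case False
    \<comment> \<open>For \<open>h = 0\<close> the bound on the number of prefixes falls below 1, so
      \<open>K'\<close> would be empty; that case is settled by giving the empty set dimension minus
      infinity.\<close>
    have "h \<noteq> 0"
    proof
      assume "h = 0"
      have "0 < ?lo" using lo_pos .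
      then obtain j where j: "\<theta> ^ j < ?lo" using real_arch_pow_inv \<theta>(2) by blast
      have "real (card (digits (j * r) ` K')) \<le> 1 / ?lo * \<theta> ^ j" using K'_card[of j] \<open>h = 0\<close> by simp
      also have "\<dots> < 1" using j lo_pos by (simp add: field_simps)
      finally show False using finite_digits_image[OF K'i] False by simp
    qed
    then have "0 < D" using h0 L by (simp add: D_def)
    \<comment> \<open>The second argument of \<open>max\<close> meets the condition of
      \<open>zero'\<close> with equality; the cut at 0 keeps the exponent admissible, and
      \<open>0 < D\<close> keeps it below \<open>D\<close>.\<close>
    define s where "s = max 0 (D + ln \<theta> / (2 * real r * ?L))"
    have "ln \<theta> / (2 * real r * ?L) < 0" using \<theta> r L by (intro divide_neg_pos) auto
    then have s: "0 \<le> s" "s < D" using \<open>0 < D\<close> by (auto simp: s_def)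
    have "D + ln \<theta> / (2 * real r * ?L) \<le> s" by (simp add: s_def)
    then have "(D + ln \<theta> / (2 * real r * ?L)) * (?L * real r) \<le> s * (?L * real r)"
      using L by (intro mult_right_mono) auto
    moreover have "(D + ln \<theta> / (2 * real r * ?L)) * (?L * real r) = h * real r + ln \<theta> / 2"
      using L r by (simp add: D_def field_simps)
    ultimately have "hausdorff_measure s K' = 0" using zero'[OF s(1)] by (simp add: mult.assoc)
    then have "hausdorff_dim K' \<le> ereal s"
      using False s(1) unfolding hausdorff_dim_def by (auto intro!: INF_lower)
    also have "\<dots> < ereal D" using s(2) by simp
    finally show ?thesis .
  qed (simp add: hausdorff_dim_def)
  ultimately show ?thesis using D0 dim pos[OF D0] fin by blast
qed

end

theorem theorem5p7:
  fixes n :: nat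
    and b k :: "nat \<Rightarrow> nat"
    and d :: "nat \<Rightarrow> 'p::prime_card padic"
    and K K' :: "'p padic set"
    and \<mu> :: "'p padic set \<Rightarrow> ennreal"
  assumes "\<And>i. i \<in> {1..n} \<Longrightarrow> b i \<in> {0, 1}"
    and "\<And>i. i \<in> {1..n} \<Longrightarrow> k i \<ge> 1"
    and "\<And>i. i \<in> {1..n} \<Longrightarrow> d i \<in> padic_ints \<inter> \<rat>"
    and "is_self_similar_set n b k d K"
    and "K' = nonessential_points n b k d K"
    and "\<mu> = hausdorff_measure (real_of_ereal (hausdorff_dim K))"
  shows "0 < \<mu> K \<and> \<mu> K < \<infinity> \<and> \<mu> K' = 0 \<and> hausdorff_dim K' < hausdorff_dim K"
proof -
  interpret padic_ifs n b k d K
    by standard (use assms(2,3,4) in auto)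
  show ?thesis using hausdorff_measure_nonessential assms(5,6) by auto
qed

end
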